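(* Let $n\ge1$ and let $\alpha,\beta\in\mathbb C^n$ satisfy $\Re\alpha_j+\Re\beta_j>-1$ and $\alpha_j,\beta_j\notin\{-1,-2,\ldots\}$ for all $1\le j\le n$. Assume a complex Borel measure $\mu$ on $\mathbb T^n$ is singular with respect to $m_n$. Then $$RNT\text{-}\lim_{z\to\zeta}P_{\alpha,\beta}[d\mu](z)=0\quad\text{for almost every }\zeta\in\mathbb T^n.$$
   Context: $\mathbb D$ is the open unit disc and $\mathbb T$ the unit circle; $m_n$ is the normalized Haar measure on $\mathbb T^n$. The $(\alpha,\beta)$-Poisson kernel is, for $z\in\mathbb D^n$, $\zeta\in\mathbb T^n$ (principal branches of powers), $$P_{\alpha,\beta}(z,\zeta)=\prod_{j=1}^n c_{\alpha_j,\beta_j}\frac{(1-|z_j|^2)^{\alpha_j+\beta_j+1}}{(1-z_j\overline{\zeta_j})^{\alpha_j+1}(1-\overline{z_j}\zeta_j)^{\beta_j+1}},\qquad c_{a,b}=\frac{\Gamma(a+1)\Gamma(b+1)}{\Gamma(a+b+1)},$$ and $P_{\alpha,\beta}[d\mu](z)=\int_{\mathbb T^n}P_{\alpha,\beta}(z,\zeta)\,d\mu(\zeta)$, $z\in\mathbb D^n$. The Stolz region at $e^{i\varphi}\in\mathbb T$ is $S_A(e^{i\varphi})=\{re^{i(\varphi-\theta)}:0\le r<1,\ |\theta|\le A(1-r)\}$. For $\eta\in\mathbb T^n$, $0<A<\infty$, $1\le B<\infty$, $S_A(\eta)=\prod_{j=1}^nS_A(\eta_j)$ and $$S_{A,B}(\eta)=\Big\{(z_1,\ldots,z_n)\in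 S_A(\eta):\max_{j,k}\frac{1-|z_j|}{1-|z_k|}\le B\Big\}.$$ $RNT$-$\lim_{z\to\eta}u(z)=l$ (restricted non-tangential limit) means: for every $0<A<\infty$ and $1\le B<\infty$ and every $\varepsilon>0$ there is $\delta>0$ such that $|u(z)-l|<\varepsilon$ whenever $|z-\eta|<\delta$ and $z\in S_{A,B}(\eta)$. *)

theory Defs
  imports "HOL-Analysis.Analysis"
begin

section \<open>Complex measures\<close>

text \<open>
  A complex measure on the measurable space underlying \<open>M\<close> (whose own measure plays no role) is a
  countably additive complex set function on \<^term>\<open>sets M\<close>; its values elsewhere are irrelevant.
  The condition includes \<open>\<mu> {} = 0\<close>, since a constant series converges only if it is zero.
\<close>

definition complex_measure :: "'a measure \<Rightarrow> ('a set \<Rightarrow> complex) \<Rightarrow> bool" where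
  "complex_measure M \<mu> \<longleftrightarrow>
     (\<forall>A :: nat \<Rightarrow> 'a set. range A \<subseteq> sets M \<longrightarrow> disjoint_family A \<longrightarrow>
        (\<lambda>i. \<mu> (A i)) sums \<mu> (\<Union>i. A i))"

text \<open>The positive variation of a real set function; the negative one is \<open>pos_variation M (\<lambda>A. - \<nu> A)\<close>.\<close>

definition pos_variation :: "'a measure \<Rightarrow> ('a set \<Rightarrow> real) \<Rightarrow> 'a measure" where
  "pos_variation M \<nu> =
     measure_of (space M) (sets M) (\<lambda>A. SUP B \<in> {B \<in> sets M. B \<subseteq> A}. ennreal (\<nu> B))"

text \<open>The integral against a real or complex measure, through its Jordan decomposition.\<close>

definition signed_integral :: "'a measure \<Rightarrow> ('a set \<Rightarrow> real) \<Rightarrow> ('a \<Rightarrow> complex) \<Rightarrow> complex" where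
  "signed_integral M \<nu> f =
     (\<integral>x. f x \<partial>pos_variation M \<nu>) - (\<integral>x. f x \<partial>pos_variation M (\<lambda>A. - \<nu> A))"

definition cmeasure_integral :: "'a measure \<Rightarrow> ('a set \<Rightarrow> complex) \<Rightarrow> ('a \<Rightarrow> complex) \<Rightarrow> complex" where
  "cmeasure_integral M \<mu> f =
     signed_integral M (\<lambda>A. Re (\<mu> A)) f + \<i> * signed_integral M (\<lambda>A. Im (\<mu> A)) f"

text \<open>\<open>\<mu>\<close> is concentrated on an \<open>M\<close>-null set.\<close>

definition cmeasure_singular :: "'a measure \<Rightarrow> ('a set \<Rightarrow> complex) \<Rightarrow> bool" where
  "cmeasure_singular M \<mu> \<longleftrightarrow>
     (\<exists>E \<in> sets M. emeasure M E = 0 \<and> (\<forall>A \<in> sets M. A \<inter> E = {} \<longrightarrow> \<mu> A = 0))"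

text \<open>
  \<^const>\<open>measure_of\<close> yields the zero measure when its argument is not countably additive, so the
  following facts are needed to see that the variations and the integral are the intended ones.
\<close>

definition signed_measure :: "'a measure \<Rightarrow> ('a set \<Rightarrow> real) \<Rightarrow> bool" where
  "signed_measure M \<nu> \<longleftrightarrow>
     (\<forall>A :: nat \<Rightarrow> 'a set. range A \<subseteq> sets M \<longrightarrow> disjoint_family A \<longrightarrow>
        (\<lambda>i. \<nu> (A i)) sums \<nu> (\<Union>i. A i))"

lemma signed_measure_Re: "complex_measure M \<mu> \<Longrightarrow> signed_measure M (\<lambda>A. Re (\<mu> A))"
  unfolding complex_measure_def signed_measure_def using sums_Re by blast

lemma signed_measure_Im: "complex_measure M \<mu> \<Longrightarrow> signed_measure M (\<lambda>A. Im (\<mu> A))"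
  unfolding complex_measure_def signed_measure_def using sums_Im by blast

lemma signed_measure_uminus: "signed_measure M \<nu> \<Longrightarrow> signed_measure M (\<lambda>A. - \<nu> A)"
  unfolding signed_measure_def using sums_minus by blast

context
  fixes M :: "'a measure" and \<nu> :: "'a set \<Rightarrow> real"
  assumes \<nu>: "signed_measure M \<nu>"
begin

abbreviation (input) "upvar A \<equiv> (SUP B \<in> {B \<in> sets M. B \<subseteq> A}. ennreal (\<nu> B))"

lemma signed_measure_sums:
  "range A \<subseteq> sets M \<Longrightarrow> disjoint_family A \<Longrightarrow> (\<lambda>i::nat. \<nu> (A i)) sums \<nu> (\<Union>i. A i)"
  using \<nu> unfolding signed_measure_def by blast

lemma signed_measure_empty: "\<nu> {} = 0"
proof -
  have "(\<lambda>i::nat. \<nu> {}) sums \<nu> (\<Union>i::nat. {})"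
    by (rule signed_measure_sums) (auto simp: disjoint_family_on_def)
  then have "summable (\<lambda>i::nat. \<nu> {})" by (rule sums_summable)
  then show ?thesis by (simp add: summable_const_iff)
qed

lemma signed_measure_Un:
  assumes "A \<in> sets M" "B \<in> sets M" "A \<inter> B = {}"
  shows "\<nu> (A \<union> B) = \<nu> A + \<nu> B"
proof -
  have r: "range (binaryset A B) \<subseteq> sets M"
    using assms by (auto simp: binaryset_def)
  have d: "disjoint_family (binaryset A B)"
    using assms by (auto simp: binaryset_def disjoint_family_on_def)
  have "(\<lambda>i. \<nu> (binaryset A B i)) sums \<nu> (A \<union> B)"
    using signed_measure_sums[OF r d] by (simp add: UN_binaryset_eq)
  moreover have "(\<lambda>i. \<nu> (binaryset A B i)) sums (\<nu> A + \<nu> B)"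
    by (rule binaryset_sums) (rule signed_measure_empty)
  ultimately show ?thesis by (rule sums_unique2)
qed

lemma signed_measure_Diff:
  assumes "A \<in> sets M" "B \<in> sets M" "B \<subseteq> A"
  shows "\<nu> (A - B) = \<nu> A - \<nu> B"
proof -
  have "\<nu> ((A - B) \<union> B) = \<nu> (A - B) + \<nu> B"
    using assms by (intro signed_measure_Un) auto
  moreover have "(A - B) \<union> B = A" using assms by auto
  ultimately show ?thesis by simp
qed

lemma upvar_upper: "B \<in> sets M \<Longrightarrow> B \<subseteq> A \<Longrightarrow> ennreal (\<nu> B) \<le> upvar A"
  by (rule SUP_upper) auto

lemma upvar_empty: "upvar {} = 0"
proof -
  have "{B \<in> sets M. B \<subseteq> {}} = {{}}" by auto
  then show ?thesis by (simp add: signed_measure_empty)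
qed

lemma upvar_superadd:
  assumes A: "A \<in> sets M" and C: "C \<in> sets M" and d: "A \<inter> C = {}"
  shows "upvar A + upvar C \<le> upvar (A \<union> C)"
proof -
  have 1: "ennreal (\<nu> B) + ennreal (\<nu> D) \<le> upvar (A \<union> C)"
    if B: "B \<in> sets M" "B \<subseteq> A" and D: "D \<in> sets M" "D \<subseteq> C" for B D
  proof -
    consider "\<nu> B \<le> 0" | "\<nu> D \<le> 0" | "\<nu> B \<ge> 0" "\<nu> D \<ge> 0" by linarith
    then show ?thesis
    proof cases
      case 1
      have "ennreal (\<nu> D) \<le> upvar (A \<union> C)" using D by (intro upvar_upper) auto
      with 1 show ?thesis by (simp add: ennreal_neg)
    next
      case 2
      have "ennreal (\<nu> B) \<le> upvar (A \<union> C)" using B by (intro upvar_upper) auto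
      with 2 show ?thesis by (simp add: ennreal_neg)
    next
      case 3
      have "B \<inter> D = {}" using B D d by auto
      then have "\<nu> (B \<union> D) = \<nu> B + \<nu> D" using B D by (intro signed_measure_Un) auto
      moreover have "ennreal (\<nu> (B \<union> D)) \<le> upvar (A \<union> C)"
        using B D by (intro upvar_upper) auto
      ultimately show ?thesis using 3 by (simp add: ennreal_plus)
    qed
  qed
  have neA: "{B \<in> sets M. B \<subseteq> A} \<noteq> {}" and neC: "{B \<in> sets M. B \<subseteq> C} \<noteq> {}" by auto
  have "upvar A + upvar C =
      (SUP B \<in> {B \<in> sets M. B \<subseteq> A}. SUP D \<in> {D \<in> sets M. D \<subseteq> C}. ennreal (\<nu> B) + ennreal (\<nu> D))"
    by (simp add: ennreal_SUP_add_left[OF neA] ennreal_SUP_add_right[OF neC, symmetric])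
  also have "\<dots> \<le> upvar (A \<union> C)"
    by (intro SUP_least) (use 1 in auto)
  finally show ?thesis .
qed

lemma upvar_mono: "A \<subseteq> C \<Longrightarrow> upvar A \<le> upvar C"
  by (rule SUP_subset_mono) auto

lemma upvar_countably_additive: "countably_additive (sets M) (\<lambda>A. upvar A)"
  unfolding countably_additive_def
proof (intro allI impI)
  fix A :: "nat \<Rightarrow> 'a set"
  assume r: "range A \<subseteq> sets M" and d: "disjoint_family A" and U: "(\<Union>i. A i) \<in> sets M"
  have Ai: "A i \<in> sets M" for i using r by auto
  have "(\<Sum>i<n. upvar (A i)) \<le> upvar (\<Union>i<n. A i)" for n
  proof (induction n)
    case 0 show ?case by simp
  next
    case (Suc n)
    have "(\<Sum>i<Suc n. upvar (A i)) \<le> upvar (\<Union>i<n. A i) + upvar (A n)"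
      using Suc by (simp add: add_right_mono)
    also have "\<dots> \<le> upvar ((\<Union>i<n. A i) \<union> A n)"
    proof (rule upvar_superadd)
      have "A i \<inter> A n = {}" if "i < n" for i
        using that d by (auto simp: disjoint_family_on_def)
      then show "(\<Union>i<n. A i) \<inter> A n = {}" by blast
    qed (use Ai in auto)
    also have "(\<Union>i<n. A i) \<union> A n = (\<Union>i<Suc n. A i)" by (auto simp: less_Suc_eq)
    finally show ?case .
  qed
  moreover have "upvar (\<Union>i<n. A i) \<le> upvar (\<Union>i. A i)" for n
    by (rule upvar_mono) auto
  ultimately have "(\<Sum>i<n. upvar (A i)) \<le> upvar (\<Union>i. A i)" for n
    by (meson order_trans)
  then have le: "(\<Sum>i. upvar (A i)) \<le> upvar (\<Union>i. A i)"
    by (intro suminf_le_const) auto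
  have ge: "upvar (\<Union>i. A i) \<le> (\<Sum>i. upvar (A i))"
  proof (rule SUP_least)
    fix B assume B: "B \<in> {B \<in> sets M. B \<subseteq> (\<Union>i. A i)}"
    have s: "(\<lambda>i. \<nu> (B \<inter> A i)) sums \<nu> (\<Union>i. B \<inter> A i)"
      using B Ai d by (intro signed_measure_sums) (auto simp: disjoint_family_on_def)
    have B': "(\<Union>i. B \<inter> A i) = B" using B by auto
    have lim: "(\<lambda>n. ennreal (\<Sum>i<n. \<nu> (B \<inter> A i))) \<longlonglongrightarrow> ennreal (\<nu> B)"
      using s unfolding B' sums_def by (intro tendsto_ennrealI)
    have "ennreal (\<Sum>i<n. \<nu> (B \<inter> A i)) \<le> (\<Sum>i. upvar (A i))" for n
    proof -
      have "ennreal (\<Sum>i<n. \<nu> (B \<inter> A i)) \<le> ennreal (\<Sum>i<n. max 0 (\<nu> (B \<inter> A i)))"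
        by (intro ennreal_leI sum_mono) auto
      also have "\<dots> = (\<Sum>i<n. ennreal (\<nu> (B \<inter> A i)))"
        by (simp add: sum_ennreal[symmetric] ennreal_max_0 del: sum_ennreal)
      also have "\<dots> \<le> (\<Sum>i<n. upvar (A i))"
        using B Ai by (intro sum_mono upvar_upper) auto
      also have "\<dots> \<le> (\<Sum>i. upvar (A i))"
        by (intro sum_le_suminf) auto
      finally show ?thesis .
    qed
    then show "ennreal (\<nu> B) \<le> (\<Sum>i. upvar (A i))"
      by (intro LIMSEQ_le_const2[OF lim]) auto
  qed
  show "(\<Sum>i. upvar (A i)) = upvar (\<Union>i. A i)" using le ge by (rule antisym)
qed

lemma sets_pos_variation: "sets (pos_variation M \<nu>) = sets M"
  and space_pos_variation: "space (pos_variation M \<nu>) = space M"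
  unfolding pos_variation_def by auto

lemma emeasure_pos_variation:
  assumes "A \<in> sets M"
  shows "emeasure (pos_variation M \<nu>) A = upvar A"
  unfolding pos_variation_def
  by (rule emeasure_measure_of_sigma)
     (use assms upvar_empty upvar_countably_additive in
       \<open>auto simp: positive_def sets.sigma_algebra_axioms\<close>)

lemma upvar_finite: "upvar (space M) < top"
proof (rule ccontr)
  assume "\<not> upvar (space M) < top"
  then have top: "upvar (space M) = top" using less_top by blast
  define Q where "Q E \<longleftrightarrow> E \<in> sets M \<and> upvar E = top" for E
  have step: "\<exists>F. Q F \<and> F \<subseteq> E \<and> \<bar>\<nu> (E - F)\<bar> \<ge> 1" if "Q E" for E
  proof -
    have E: "E \<in> sets M" and Etop: "upvar E = top" using that by (auto simp: Q_def)
    have "ennreal (1 + \<bar>\<nu> E\<bar>) < upvar E" unfolding Etop by simp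
    then obtain B where B: "B \<in> sets M" "B \<subseteq> E" and lt: "ennreal (1 + \<bar>\<nu> E\<bar>) < ennreal (\<nu> B)"
      unfolding less_SUP_iff by auto
    have big: "1 + \<bar>\<nu> E\<bar> < \<nu> B" using lt by (subst (asm) ennreal_less_iff) auto
    have EB: "E - B \<in> sets M" using E B by auto
    have diff: "\<nu> (E - B) = \<nu> E - \<nu> B" using E B by (intro signed_measure_Diff)
    have "emeasure (pos_variation M \<nu>) B + emeasure (pos_variation M \<nu>) (E - B)
        = emeasure (pos_variation M \<nu>) (B \<union> (E - B))"
      using B EB by (intro plus_emeasure) (auto simp: sets_pos_variation)
    moreover have "B \<union> (E - B) = E" using B by auto
    ultimately have "upvar B + upvar (E - B) = top"
      using B E EB Etop by (simp add: emeasure_pos_variation)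
    then consider "upvar B = top" | "upvar (E - B) = top" by (auto simp: ennreal_add_eq_top)
    then show ?thesis
    proof cases
      case 1
      then have "Q B" using B by (simp add: Q_def)
      then show ?thesis using B diff big by (intro exI[of _ B]) auto
    next
      case 2
      then have "Q (E - B)" using EB by (simp add: Q_def)
      moreover have "E - (E - B) = B" using B by auto
      ultimately show ?thesis using big by (intro exI[of _ "E - B"]) auto
    qed
  qed
  have "\<exists>F. \<forall>n. Q (F n) \<and> (F (Suc n) \<subseteq> F n \<and> \<bar>\<nu> (F n - F (Suc n))\<bar> \<ge> 1)"
    by (rule dependent_nat_choice)
       (use top step in \<open>auto simp: Q_def intro!: exI[of _ "space M"]\<close>)
  then obtain F :: "nat \<Rightarrow> 'a set" where
    F: "\<And>n. F n \<in> sets M" "\<And>n. F (Suc n) \<subseteq> F n" "\<And>n. \<bar>\<nu> (F n - F (Suc n))\<bar> \<ge> 1"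
    by (auto simp: Q_def)
  have dec: "decseq F" using F(2) by (rule decseq_SucI)
  have "disjoint_family (\<lambda>n. F n - F (Suc n))"
    unfolding disjoint_family_on_def
  proof (intro ballI impI)
    fix m n :: nat assume "m \<noteq> n"
    then consider "Suc m \<le> n" | "Suc n \<le> m" by linarith
    then show "(F m - F (Suc m)) \<inter> (F n - F (Suc n)) = {}"
      by cases (use dec in \<open>auto simp: decseq_def\<close>)
  qed
  then have "(\<lambda>n. \<nu> (F n - F (Suc n))) sums \<nu> (\<Union>n. F n - F (Suc n))"
    using F(1) by (intro signed_measure_sums) auto
  then have "(\<lambda>n. \<nu> (F n - F (Suc n))) \<longlonglongrightarrow> 0"
    by (intro summable_LIMSEQ_zero sums_summable)
  then have "eventually (\<lambda>n. \<bar>\<nu> (F n - F (Suc n))\<bar> < 1) sequentially"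
    by (auto dest!: tendstoD[where e=1])
  then show False using F(3) by (auto simp: eventually_sequentially not_less[symmetric])
qed

lemma finite_measure_pos_variation: "finite_measure (pos_variation M \<nu>)"
proof (rule finite_measureI)
  show "emeasure (pos_variation M \<nu>) (space (pos_variation M \<nu>)) \<noteq> \<infinity>"
    unfolding space_pos_variation emeasure_pos_variation[OF sets.top]
    using upvar_finite by (metis infinity_ennreal_def less_irrefl)
qed

end

lemma jordan_decomposition:
  assumes \<nu>: "signed_measure M \<nu>" and A: "A \<in> sets M"
  shows "\<nu> A = measure (pos_variation M \<nu>) A - measure (pos_variation M (\<lambda>A. - \<nu> A)) A"
proof -
  note \<nu>' = signed_measure_uminus[OF \<nu>]
  interpret P: finite_measure "pos_variation M \<nu>" by (rule finite_measure_pos_variation[OF \<nu>])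
  interpret N: finite_measure "pos_variation M (\<lambda>A. - \<nu> A)"
    by (rule finite_measure_pos_variation[OF \<nu>'])
  have up: "r B \<le> measure (pos_variation M r) A"
    if r: "signed_measure M r" and B: "B \<in> sets M" "B \<subseteq> A" for r B
  proof -
    interpret R: finite_measure "pos_variation M r" by (rule finite_measure_pos_variation[OF r])
    have "ennreal (r B) \<le> emeasure (pos_variation M r) A"
      unfolding emeasure_pos_variation[OF r A] using B by (rule upvar_upper[OF r])
    then show ?thesis unfolding R.emeasure_eq_measure by (simp add: ennreal_le_iff)
  qed
  have least: "measure (pos_variation M r) A \<le> c"
    if r: "signed_measure M r" and c: "\<And>B. B \<in> sets M \<Longrightarrow> B \<subseteq> A \<Longrightarrow> r B \<le> c" for r c
  proof -
    interpret R: finite_measure "pos_variation M r" by (rule finite_measure_pos_variation[OF r])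
    have c0: "0 \<le> c" using c[of "{}"] signed_measure_empty[OF r] by simp
    have "emeasure (pos_variation M r) A \<le> ennreal c"
      unfolding emeasure_pos_variation[OF r A] by (rule SUP_least) (auto intro!: ennreal_leI c)
    then show ?thesis using c0 unfolding R.emeasure_eq_measure by (simp add: ennreal_le_iff)
  qed
  have "measure (pos_variation M \<nu>) A \<le> \<nu> A + measure (pos_variation M (\<lambda>A. - \<nu> A)) A"
  proof (rule least[OF \<nu>])
    fix B assume B: "B \<in> sets M" "B \<subseteq> A"
    show "\<nu> B \<le> \<nu> A + measure (pos_variation M (\<lambda>A. - \<nu> A)) A"
      using up[OF \<nu>', of "A - B"] signed_measure_Diff[OF \<nu> A B] A B by auto
  qed
  moreover have "measure (pos_variation M (\<lambda>A. - \<nu> A)) A \<le> measure (pos_variation M \<nu>) A - \<nu> A"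
  proof (rule least[OF \<nu>'])
    fix B assume B: "B \<in> sets M" "B \<subseteq> A"
    show "- \<nu> B \<le> measure (pos_variation M \<nu>) A - \<nu> A"
      using up[OF \<nu>, of "A - B"] signed_measure_Diff[OF \<nu> A B] A B by auto
  qed
  ultimately show ?thesis by simp
qed

lemma cmeasure_integral_indicator:
  assumes \<mu>: "complex_measure M \<mu>" and A: "A \<in> sets M"
  shows "cmeasure_integral M \<mu> (indicator A) = \<mu> A"
proof -
  have "signed_integral M r (indicator A) = of_real (r A)" if r: "signed_measure M r" for r
  proof -
    note r' = signed_measure_uminus[OF r]
    have "(\<integral>x. indicator A x \<partial>pos_variation M s) = complex_of_real (measure (pos_variation M s) A)"
      if s: "signed_measure M s" for s
    proof -
      interpret S: finite_measure "pos_variation M s" by (rule finite_measure_pos_variation[OF s])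
      have "has_bochner_integral (pos_variation M s) (\<lambda>x. indicator A x *\<^sub>R (1::complex))
          (measure (pos_variation M s) A *\<^sub>R 1)"
        by (intro has_bochner_integral_indicator)
           (use A S.emeasure_finite[of A] in \<open>auto simp: sets_pos_variation[OF s] less_top[symmetric]\<close>)
      moreover have "(\<lambda>x. indicator A x *\<^sub>R (1::complex)) = indicator A"
        by (auto simp: indicator_def)
      ultimately show ?thesis
        by (metis has_bochner_integral_integral_eq scaleR_conv_of_real mult.right_neutral)
    qed
    from this[OF r] this[OF r'] show ?thesis
      unfolding signed_integral_def using jordan_decomposition[OF r A] by simp
  qed
  from this[OF signed_measure_Re[OF \<mu>]] this[OF signed_measure_Im[OF \<mu>]] show ?thesis
    unfolding cmeasure_integral_def by (simp add: complex_eq_iff)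
qed


section \<open>The torus and its Haar measure\<close>

definition torus :: "(complex ^ 'n::finite) set" where
  "torus = {\<zeta>. \<forall>j. \<zeta> $ j \<in> sphere 0 1}"

text \<open>
  The normalized Haar measure: the image of the normalized Lebesgue measure on \<open>[0, 2\<pi>]\<^sup>n\<close> under
  \<open>(t\<^sub>j) \<mapsto> (e\<^bsup>i t\<^sub>j\<^esup>)\<close>, on the Borel sets of the torus.
\<close>

definition haar_torus :: "(complex ^ 'n::finite) measure" where
  "haar_torus =
     distr (uniform_measure lborel (cbox 0 (\<chi> j. 2 * pi)))
       (restrict_space borel torus) (\<lambda>t :: real ^ 'n. \<chi> j. cis (t $ j))"

lemma space_haar_torus: "space haar_torus = torus"
  by (simp add: haar_torus_def space_restrict_space)

lemma sets_haar_torus: "sets haar_torus = sets (restrict_space borel torus)"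
  by (simp add: haar_torus_def)

lemma emeasure_haar_torus: "emeasure haar_torus (torus :: (complex ^ 'n::finite) set) = 1"
proof -
  have "(\<lambda>t :: real ^ 'n. \<chi> j. cis (t $ j)) \<in> borel_measurable borel"
    by (intro borel_measurable_continuous_onI continuous_intros)
  then have meas: "(\<lambda>t :: real ^ 'n. \<chi> j. cis (t $ j))
      \<in> uniform_measure lborel (cbox 0 (\<chi> j. 2 * pi)) \<rightarrow>\<^sub>M restrict_space borel torus"
    by (intro measurable_restrict_space2) (auto simp: torus_def cong: measurable_cong_sets)
  have torus: "torus \<in> sets (restrict_space borel (torus :: (complex ^ 'n) set))"
    by (metis sets.top space_borel space_restrict_space Int_UNIV_right)
  have pos: "emeasure lborel (cbox 0 (\<chi> j. 2 * pi) :: (real ^ 'n) set) \<noteq> 0"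
  proof -
    have "(\<chi> j. 2 * pi :: real ^ 'n) \<bullet> b = 2 * pi" if "b \<in> Basis" for b
      using that by (auto simp: Basis_vec_def inner_axis)
    then show ?thesis by (simp add: emeasure_lborel_cbox_eq)
  qed
  have "emeasure haar_torus (torus :: (complex ^ 'n) set)
      = emeasure (uniform_measure lborel (cbox 0 (\<chi> j. 2 * pi :: real ^ 'n))) UNIV"
    unfolding haar_torus_def emeasure_distr[OF meas torus]
    by (rule arg_cong[where f = "emeasure _"]) (auto simp: torus_def)
  also have "\<dots> = 1"
    using emeasure_lborel_cbox_finite[of "0 :: real ^ 'n" "\<chi> j. 2 * pi"] pos
    by (simp add: ennreal_divide_self less_top[symmetric])
  finally show ?thesis .
qed


section \<open>The Poisson kernel and restricted non-tangential limits\<close>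

definition poisson_const :: "complex \<Rightarrow> complex \<Rightarrow> complex" where
  "poisson_const a b = Gamma (a + 1) * Gamma (b + 1) / Gamma (a + b + 1)"

definition poisson_kernel ::
  "complex ^ 'n::finite \<Rightarrow> complex ^ 'n \<Rightarrow> complex ^ 'n \<Rightarrow> complex ^ 'n \<Rightarrow> complex" where
  "poisson_kernel \<alpha> \<beta> z \<zeta> =
     (\<Prod>j\<in>UNIV. poisson_const (\<alpha> $ j) (\<beta> $ j) *
        (of_real (1 - (cmod (z $ j))\<^sup>2) powr (\<alpha> $ j + \<beta> $ j + 1) /
         ((1 - z $ j * cnj (\<zeta> $ j)) powr (\<alpha> $ j + 1) *
          (1 - cnj (z $ j) * \<zeta> $ j) powr (\<beta> $ j + 1))))"

definition poisson_integral ::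
  "complex ^ 'n::finite \<Rightarrow> complex ^ 'n \<Rightarrow> ((complex ^ 'n) set \<Rightarrow> complex) \<Rightarrow> complex ^ 'n \<Rightarrow> complex"
where
  "poisson_integral \<alpha> \<beta> \<mu> z =
     cmeasure_integral (restrict_space borel torus) \<mu> (\<lambda>\<zeta>. poisson_kernel \<alpha> \<beta> z \<zeta>)"

text \<open>For \<open>\<eta> = e\<^bsup>i\<phi>\<^esup>\<close> the points below are \<open>r e\<^bsup>i(\<phi> - \<theta>)\<^esup>\<close>.\<close>

definition stolz :: "real \<Rightarrow> complex \<Rightarrow> complex set" where
  "stolz A \<eta> = {of_real r * (\<eta> * cis (- \<theta>)) | r \<theta>. 0 \<le> r \<and> r < 1 \<and> \<bar>\<theta>\<bar> \<le> A * (1 - r)}"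

definition restricted_stolz :: "real \<Rightarrow> real \<Rightarrow> complex ^ 'n::finite \<Rightarrow> (complex ^ 'n) set" where
  "restricted_stolz A B \<eta> =
     {z. (\<forall>j. z $ j \<in> stolz A (\<eta> $ j)) \<and>
         Max (range (\<lambda>(j, k). (1 - cmod (z $ j)) / (1 - cmod (z $ k)))) \<le> B}"

definition RNT_lim :: "(complex ^ 'n::finite \<Rightarrow> complex) \<Rightarrow> complex ^ 'n \<Rightarrow> complex \<Rightarrow> bool" where
  "RNT_lim u \<eta> l \<longleftrightarrow>
     (\<forall>A>0. \<forall>B\<ge>1. \<forall>\<epsilon>>0. \<exists>\<delta>>0. \<forall>z. norm (z - \<eta>) < \<delta> \<and> z \<in> restricted_stolz A B \<eta> \<longrightarrow>
        cmod (u z - l) < \<epsilon>)"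

end

theory Submission
  imports Defs
begin

text \<open>
  The kernel is a product of one-variable factors. For \<open>z\<close> in a restricted Stolz region at \<open>\<eta>\<close>, all
  the numbers \<open>1 - |z\<^sub>j|\<close> are comparable to a common \<open>t\<close>, and the \<open>j\<close>-th factor is at most a constant times
  \<open>t\<^sup>-\<^sup>1 max(1, |\<zeta>\<^sub>j - \<eta>\<^sub>j| / t)\<^bsup>-(1 + \<sigma>)\<^esup>\<close>, where \<open>\<sigma> > 0\<close> is the least of the numbers
  \<open>Re \<alpha>\<^sub>j + Re \<beta>\<^sub>j + 1\<close>. If \<open>\<sigma>\<close> is small, this bound does not decay fast enough in \<open>max\<^sub>j |\<zeta>\<^sub>j - \<eta>\<^sub>j|\<close> for a
  maximal function over cubes to suffice, and the product structure has to be kept.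

  The torus is therefore covered by the dyadic polydiscs around \<open>\<eta>\<close> with radii \<open>2\<^bsup>k j\<^esup> t\<close>, one for
  each shape \<open>k\<close> in \<open>\<nat>\<^sup>n\<close>. If the one with shape \<open>k\<close> is the least that contains \<open>\<zeta>\<close>, the
  kernel is at most a constant times
  \<open>t\<^sup>-\<^sup>n \<Prod>\<^sub>j 2\<^bsup>-(1 + \<sigma>) k j\<^esup>\<close> (lemma \<open>poisson_kernel_le_dyadic\<close>). Since the volume of the polydisc is
  about \<open>t\<^sup>n \<Prod>\<^sub>j 2\<^bsup>k j\<^esup>\<close>, the Poisson integral of a positive measure is bounded by a sum over \<open>k\<close> of
  means over polydiscs of shape \<open>k\<close>, with the summable weights \<open>\<Prod>\<^sub>j 2\<^bsup>-\<sigma> k j\<^esup>\<close>.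

  For a fixed shape, the means satisfy a weak type inequality by a Vitali covering argument, with a
  constant that does not depend on the shape (lemma \<open>ellipsoid_maximal_inequality\<close>). This has two
  consequences at almost every \<open>\<eta>\<close>. The maximal functions of the shapes \<open>k\<close> grow so slowly with \<open>k\<close> that
  the sum converges uniformly in \<open>t\<close> (lemma \<open>AE_ellipsoid_growth\<close>). And if the measure is singular, each
  single mean tends to zero with \<open>t\<close> (lemma \<open>AE_ellipsoid_density_zero\<close>). By dominated convergence for
  series the whole sum tends to zero. The Jordan decomposition of the real and imaginary parts reduces
  a complex measure to four positive ones.
\<close>

section \<open>Haar measure of products of arcs\<close>

lemma sin_ge_linear:
  fixes u :: real
  assumes "\<bar>u\<bar> \<le> pi / 2"
  shows "2 / pi * \<bar>u\<bar> \<le> \<bar>sin u\<bar>"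
proof -
  have "convex_on {0..pi/2} (\<lambda>x::real. - sin x)"
    by (rule convex_on_realI[where f' = "\<lambda>x. - cos x"])
       (auto intro!: derivative_eq_intros cos_monotone_0_pi_le)
  from convex_onD[OF this, of "2 * \<bar>u\<bar> / pi" 0 "pi / 2"] assms
  have "2 / pi * \<bar>u\<bar> \<le> sin \<bar>u\<bar>"
    by (simp add: field_simps)
  also have "\<dots> \<le> \<bar>sin u\<bar>"
    by (auto simp: abs_if)
  finally show ?thesis .
qed

lemma dist_cis: "cmod (cis s - cis t) = 2 * \<bar>sin ((s - t) / 2)\<bar>"
proof -
  have "(cmod (cis s - cis t))\<^sup>2 = (cos s - cos t)\<^sup>2 + (sin s - sin t)\<^sup>2"
    by (simp add: cmod_power2)
  also have "\<dots> = 2 - 2 * cos (s - t)"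
    using sin_cos_squared_add[of s] sin_cos_squared_add[of t]
    by (simp add: cos_diff power2_eq_square algebra_simps)
  also have "\<dots> = (2 * \<bar>sin ((s - t) / 2)\<bar>)\<^sup>2"
    using cos_double_sin[of "(s - t) / 2"] by (simp add: power_mult_distrib diff_divide_distrib)
  finally show ?thesis
    by (rule power2_eq_imp_eq) auto
qed

text \<open>
  The chordal distance controls the angular one on the circle. The argument of \<open>\<eta>\<close> lies in
  \<open>(-\<pi>, \<pi>]\<close> but the angles that parametrise the Haar measure lie in \<open>[0, 2\<pi>]\<close>, so the nearest
  angle of \<open>\<eta>\<close> to \<open>t\<close> may be one full turn away from its argument.
\<close>

lemma arc_subset_intervals:
  assumes \<eta>: "cmod \<eta> = 1" and t: "0 \<le> t" "t \<le> 2 * pi" and le: "cmod (cis t - \<eta>) \<le> \<rho>"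
  shows "\<exists>m\<in>{0, 1::int}. \<bar>t - (Arg \<eta> + 2 * pi * of_int m)\<bar> \<le> pi * \<rho> / 2"
proof -
  define u where "u = (t - Arg \<eta>) / 2"
  have \<eta>': "\<eta> = cis (Arg \<eta>)"
    using \<eta> by (subst cis_Arg) (auto simp: sgn_div_norm)
  have "2 * \<bar>sin u\<bar> \<le> \<rho>"
    using le unfolding u_def by (metis \<eta>' dist_cis)
  moreover obtain m :: int where m: "m \<in> {0, 1}" "\<bar>u - pi * of_int m\<bar> \<le> pi / 2"
  proof (cases "u \<le> pi / 2")
    case True
    then show ?thesis
      using that[of 0] Arg_bounded[of \<eta>] t by (simp add: u_def abs_le_iff)
  next
    case False
    then have "pi < t - Arg \<eta>" "t - Arg \<eta> \<le> 3 * pi"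
      using Arg_bounded[of \<eta>] t by (simp_all add: u_def)
    then have "\<bar>u - pi\<bar> \<le> pi / 2"
      unfolding u_def abs_le_iff by (simp add: field_simps)
    then show ?thesis
      using that[of 1] by simp
  qed
  moreover have "\<bar>sin (u - pi * of_int m)\<bar> = \<bar>sin u\<bar>"
    using m(1) by (auto simp: sin_diff)
  ultimately have "2 / pi * \<bar>u - pi * of_int m\<bar> \<le> \<rho> / 2"
    using sin_ge_linear[OF m(2)] by simp
  then have "2 * \<bar>u - pi * of_int m\<bar> \<le> pi * \<rho> / 2"
    by (simp add: field_simps)
  then have "\<bar>2 * (u - pi * of_int m)\<bar> \<le> pi * \<rho> / 2"
    by (simp only: abs_mult abs_numeral)
  moreover have "2 * (u - pi * of_int m) = t - (Arg \<eta> + 2 * pi * of_int m)"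
    by (simp add: u_def field_simps)
  ultimately show ?thesis
    using m(1) by metis
qed

lemma prod_Basis_cart:
  fixes g :: "real \<Rightarrow> 'b::comm_monoid_mult"
  shows "(\<Prod>b\<in>Basis. g (x \<bullet> b)) = (\<Prod>j\<in>UNIV. g ((x :: real ^ 'n::finite) $ j))"
proof -
  have B: "(Basis :: (real ^ 'n) set) = (\<lambda>j. axis j 1) ` UNIV"
    by (auto simp: Basis_vec_def)
  have "inj (\<lambda>j::'n. axis j (1::real))"
    by (auto simp: inj_on_def axis_eq_axis)
  then show ?thesis
    unfolding B by (subst prod.reindex) (auto simp: inner_axis)
qed

lemma emeasure_lborel_cbox_cart:
  fixes l u :: "real ^ 'n::finite"
  assumes "\<And>j. l $ j \<le> u $ j"
  shows "emeasure lborel (cbox l u) = ennreal (\<Prod>j\<in>UNIV. u $ j - l $ j)"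
proof -
  have "emeasure lborel (cbox l u) = (\<Prod>b\<in>Basis. ennreal ((u - l) \<bullet> b))"
  proof -
    have le: "l \<bullet> b \<le> u \<bullet> b" if "b \<in> Basis" for b
      using assms that by (auto simp: Basis_vec_def inner_axis)
    then show ?thesis
      by (subst emeasure_lborel_cbox) (auto simp: inner_diff_left intro!: prod_ennreal[symmetric])
  qed
  also have "\<dots> = (\<Prod>j\<in>UNIV. ennreal ((u - l) $ j))"
    by (rule prod_Basis_cart[where g = ennreal])
  also have "\<dots> = ennreal (\<Prod>j\<in>UNIV. u $ j - l $ j)"
    using assms by (simp add: prod_ennreal)
  finally show ?thesis .
qed

lemma borel_if_sets_haar_torus:
  fixes A :: "(complex ^ 'n::finite) set"
  assumes "A \<in> sets haar_torus"
  shows "A \<in> sets borel"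
proof -
  have "torus \<in> sets (borel :: (complex ^ 'n) measure)"
    unfolding torus_def by (auto intro!: borel_closed closed_Collect_all closed_Collect_eq continuous_intros)
  then show ?thesis
    using assms by (auto simp: sets_haar_torus sets_restrict_space)
qed

lemma emeasure_haar_torus_eq:
  fixes A :: "(complex ^ 'n::finite) set"
  assumes "A \<in> sets haar_torus"
  shows "emeasure haar_torus A =
    emeasure lborel (cbox 0 (\<chi> j. 2 * pi) \<inter> {t :: real ^ 'n. (\<chi> j. cis (t $ j)) \<in> A}) /
    ennreal ((2 * pi) ^ CARD('n))"
proof -
  have c: "(\<lambda>t :: real ^ 'n. \<chi> j. cis (t $ j)) \<in> borel_measurable borel"
    by (intro borel_measurable_continuous_onI continuous_intros)
  then have m: "(\<lambda>t :: real ^ 'n. \<chi> j. cis (t $ j))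
      \<in> uniform_measure lborel (cbox 0 (\<chi> j. 2 * pi)) \<rightarrow>\<^sub>M restrict_space borel torus"
    by (intro measurable_restrict_space2) (auto simp: torus_def cong: measurable_cong_sets)
  have A: "A \<in> sets (restrict_space borel torus)"
    using assms by (simp add: sets_haar_torus)
  then have v: "(\<lambda>t. \<chi> j. cis (t $ j)) -` A \<inter> UNIV \<in> sets (borel :: (real ^ 'n) measure)"
    using measurable_sets[OF m A] by simp
  have "emeasure haar_torus A = emeasure (uniform_measure lborel (cbox 0 (\<chi> j. 2 * pi)))
      ((\<lambda>t. \<chi> j. cis (t $ j)) -` A \<inter> UNIV)"
    unfolding haar_torus_def by (subst emeasure_distr[OF m A]) simp
  also have "\<dots> = emeasure lborel (cbox 0 (\<chi> j. 2 * pi) \<inter> ((\<lambda>t. \<chi> j. cis (t $ j)) -` A \<inter> UNIV)) /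
      emeasure lborel (cbox 0 (\<chi> j. 2 * pi) :: (real ^ 'n) set)"
    using v by (intro emeasure_uniform_measure) auto
  also have "emeasure lborel (cbox 0 (\<chi> j. 2 * pi) :: (real ^ 'n) set) = ennreal ((2 * pi) ^ CARD('n))"
    by (subst emeasure_lborel_cbox_cart) auto
  finally show ?thesis
    by (simp add: vimage_def)
qed

text \<open>
  Each arc is covered by two intervals of angles, so the product of the arcs is covered by \<open>2\<^sup>n\<close>
  boxes of volume \<open>\<Prod>\<^sub>j \<pi> \<rho>\<^sub>j\<close>; dividing by \<open>(2\<pi>)\<^sup>n\<close> leaves exactly \<open>\<Prod>\<^sub>j \<rho>\<^sub>j\<close>.
\<close>

lemma emeasure_haar_torus_arcs:
  fixes \<eta> :: "complex ^ 'n::finite"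
  assumes \<eta>: "\<eta> \<in> torus" and \<rho>: "\<And>j. 0 \<le> \<rho> j"
  shows "emeasure haar_torus {\<zeta> \<in> torus. \<forall>j. cmod (\<zeta> $ j - \<eta> $ j) \<le> \<rho> j} \<le> ennreal (\<Prod>j\<in>UNIV. \<rho> j)"
proof -
  let ?S = "{\<zeta> :: complex ^ 'n. \<forall>j. cmod (\<zeta> $ j - \<eta> $ j) \<le> \<rho> j}"
  let ?I = "PiE UNIV (\<lambda>_. {0, 1::int}) :: ('n \<Rightarrow> int) set"
  let ?c = "\<lambda>(m :: 'n \<Rightarrow> int) j. Arg (\<eta> $ j) + 2 * pi * of_int (m j)"
  let ?box = "\<lambda>m. cbox (\<chi> j. ?c m j - pi * \<rho> j / 2) (\<chi> j. ?c m j + pi * \<rho> j / 2) :: (real ^ 'n) set"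
  have "closed ?S"
    by (intro closed_Collect_all closed_Collect_le continuous_intros)
  then have S: "{\<zeta> \<in> torus. \<forall>j. cmod (\<zeta> $ j - \<eta> $ j) \<le> \<rho> j} \<in> sets haar_torus"
    unfolding sets_haar_torus sets_restrict_space by (auto intro!: image_eqI[of _ _ ?S])
  have sub: "cbox 0 (\<chi> j. 2 * pi) \<inter> {t :: real ^ 'n. (\<chi> j. cis (t $ j)) \<in>
      {\<zeta> \<in> torus. \<forall>j. cmod (\<zeta> $ j - \<eta> $ j) \<le> \<rho> j}} \<subseteq> (\<Union>m\<in>?I. ?box m)"
  proof safe
    fix t :: "real ^ 'n"
    assume t: "t \<in> cbox 0 (\<chi> j. 2 * pi)" and le: "\<forall>j. cmod ((\<chi> j. cis (t $ j)) $ j - \<eta> $ j) \<le> \<rho> j"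
    have "\<exists>m\<in>{0, 1::int}. \<bar>t $ j - (Arg (\<eta> $ j) + 2 * pi * of_int m)\<bar> \<le> pi * \<rho> j / 2" for j
      using \<eta> t le by (intro arc_subset_intervals) (auto simp: torus_def mem_box_cart)
    then obtain m :: "'n \<Rightarrow> int" where
      m: "\<And>j. m j \<in> {0, 1}" "\<And>j. \<bar>t $ j - ?c m j\<bar> \<le> pi * \<rho> j / 2"
      by metis
    have "t \<in> ?box m"
      unfolding mem_box_cart
    proof (intro allI)
      fix j
      show "(\<chi> j. ?c m j - pi * \<rho> j / 2) $ j \<le> t $ j \<and> t $ j \<le> (\<chi> j. ?c m j + pi * \<rho> j / 2) $ j"
        using m(2)[of j] by (simp only: vec_lambda_beta abs_le_iff) linarith
    qed
    with m(1) show "t \<in> (\<Union>m\<in>?I. ?box m)"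
      by (auto simp: PiE_def)
  qed
  have fin: "finite ?I"
    by (intro finite_PiE) auto
  have "emeasure lborel (cbox 0 (\<chi> j. 2 * pi) \<inter> {t :: real ^ 'n. (\<chi> j. cis (t $ j)) \<in>
      {\<zeta> \<in> torus. \<forall>j. cmod (\<zeta> $ j - \<eta> $ j) \<le> \<rho> j}}) \<le> emeasure lborel (\<Union>m\<in>?I. ?box m)"
    by (intro emeasure_mono[OF sub] sets.finite_UN fin) auto
  also have "\<dots> \<le> (\<Sum>m\<in>?I. emeasure lborel (?box m))"
    by (intro emeasure_subadditive_finite fin) auto
  also have "\<dots> = (\<Sum>m\<in>?I. ennreal (\<Prod>j\<in>UNIV. pi * \<rho> j))"
    using \<rho> by (intro sum.cong refl, subst emeasure_lborel_cbox_cart) auto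
  also have "\<dots> = ennreal (2 ^ CARD('n) * (\<Prod>j\<in>UNIV. pi * \<rho> j))"
    using \<rho> by (simp add: card_PiE ennreal_mult prod_nonneg flip: ennreal_power)
  also have "2 ^ CARD('n) * (\<Prod>j\<in>UNIV. pi * \<rho> j) = (2 * pi) ^ CARD('n) * (\<Prod>j\<in>UNIV. \<rho> j)"
    by (simp add: prod.distrib power_mult_distrib)
  finally have "emeasure haar_torus {\<zeta> \<in> torus. \<forall>j. cmod (\<zeta> $ j - \<eta> $ j) \<le> \<rho> j} \<le>
      ennreal ((2 * pi) ^ CARD('n) * (\<Prod>j\<in>UNIV. \<rho> j)) / ennreal ((2 * pi) ^ CARD('n))"
    unfolding emeasure_haar_torus_eq[OF S] by (rule divide_right_mono_ennreal)
  also have "\<dots> = ennreal (\<Prod>j\<in>UNIV. \<rho> j)"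
    using \<rho> by (subst divide_ennreal) (auto simp: prod_nonneg)
  finally show ?thesis .
qed

section \<open>Maximal inequality for ellipsoids of a fixed shape\<close>

text \<open>
  Exceptional sets defined through suprema over radii are not known to be measurable; it is enough
  to cover them by measurable sets of arbitrarily small measure.
\<close>

lemma AE_I_outer_measure:
  assumes "\<And>\<epsilon>::real. 0 < \<epsilon> \<Longrightarrow> \<exists>V\<in>sets M. {x \<in> space M. \<not> P x} \<subseteq> V \<and> emeasure M V \<le> ennreal \<epsilon>"
  shows "AE x in M. P x"
proof -
  have "\<forall>m::nat. \<exists>V\<in>sets M. {x \<in> space M. \<not> P x} \<subseteq> V \<and> emeasure M V \<le> ennreal (inverse (real (Suc m)))"
    using assms by simp
  then obtain V where V: "\<And>m::nat. V m \<in> sets M" "\<And>m. {x \<in> space M. \<not> P x} \<subseteq> V m"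
      "\<And>m. emeasure M (V m) \<le> ennreal (inverse (real (Suc m)))"
    by metis
  have "emeasure M (\<Inter>m. V m) \<le> ennreal (inverse (real (Suc m)))" for m
    using V(1) by (intro order_trans[OF emeasure_mono V(3)]) auto
  moreover have "(\<lambda>m. ennreal (inverse (real (Suc m)))) \<longlonglongrightarrow> ennreal 0"
    by (intro tendsto_ennrealI LIMSEQ_inverse_real_of_nat)
  ultimately have "emeasure M (\<Inter>m. V m) \<le> ennreal 0"
    by (intro LIMSEQ_le_const) auto
  then show ?thesis
    using V by (intro AE_I[where N = "\<Inter>m. V m"]) auto
qed

text \<open>Shrinks the \<open>j\<close>-th coordinate by the factor \<open>2\<^bsup>k j\<^esup>\<close>.\<close>

definition rescale :: "('n \<Rightarrow> nat) \<Rightarrow> complex ^ 'n::finite \<Rightarrow> complex ^ 'n" where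
  "rescale k \<zeta> = (\<chi> j. \<zeta> $ j /\<^sub>R 2 ^ k j)"

text \<open>
  The preimage of a Euclidean ball under \<^const>\<open>rescale\<close>. It is comparable to the polydisc with radii
  \<open>2\<^bsup>k j\<^esup> r\<close>; taking ellipsoids instead of polydiscs makes the Vitali covering lemma for Euclidean
  balls applicable to every fixed shape \<open>k\<close>, with a constant that does not depend on \<open>k\<close>.
\<close>

definition ellipsoid :: "('n \<Rightarrow> nat) \<Rightarrow> complex ^ 'n::finite \<Rightarrow> real \<Rightarrow> (complex ^ 'n) set" where
  "ellipsoid k \<eta> r = {\<zeta>. dist (rescale k \<eta>) (rescale k \<zeta>) \<le> r}"

lemma continuous_on_rescale [continuous_intros]:
  "continuous_on S f \<Longrightarrow> continuous_on S (\<lambda>x. rescale k (f x))"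
  unfolding rescale_def by (intro continuous_intros)

lemma closed_ellipsoid: "closed (ellipsoid k \<eta> r)"
  unfolding ellipsoid_def by (intro closed_Collect_le continuous_intros)

lemma borel_ellipsoid [measurable, simp]: "ellipsoid k \<eta> r \<in> sets borel"
  by (intro borel_closed closed_ellipsoid)

lemma rescale_diff: "rescale k x - rescale k y = rescale k (x - y)"
  by (simp add: rescale_def vec_eq_iff scaleR_diff_right)

lemma norm_rescale_nth: "cmod (rescale k x $ j) = cmod (x $ j) / 2 ^ k j"
  by (simp add: rescale_def divide_inverse)

lemma ellipsoid_coordinate:
  assumes "\<zeta> \<in> ellipsoid k \<eta> r"
  shows "cmod (\<zeta> $ j - \<eta> $ j) \<le> 2 ^ k j * r"
proof -
  have "norm (rescale k (\<eta> - \<zeta>) $ j) \<le> norm (rescale k (\<eta> - \<zeta>))"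
    by (rule Finite_Cartesian_Product.norm_nth_le)
  also have "\<dots> \<le> r"
    using assms by (simp add: ellipsoid_def dist_norm rescale_diff)
  finally show ?thesis
    by (simp add: norm_rescale_nth norm_minus_commute field_simps)
qed

lemma ellipsoid_memI:
  fixes \<zeta> \<eta> :: "complex ^ 'n::finite"
  assumes "\<And>j. cmod (\<zeta> $ j - \<eta> $ j) \<le> 2 ^ k j * r"
  shows "\<zeta> \<in> ellipsoid k \<eta> (of_nat CARD('n) * r)"
proof -
  have "dist (rescale k \<eta>) (rescale k \<zeta>) \<le> (\<Sum>j\<in>UNIV. norm (rescale k (\<eta> - \<zeta>) $ j))"
    unfolding dist_norm rescale_diff norm_vec_def by (rule L2_set_le_sum) auto
  also have "\<dots> \<le> (\<Sum>j\<in>(UNIV :: 'n set). r)"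
    using assms by (intro sum_mono) (simp add: norm_rescale_nth norm_minus_commute pos_divide_le_eq mult.commute)
  finally show ?thesis
    by (simp add: ellipsoid_def)
qed

lemma ellipsoid_shrinks:
  assumes "open U" "\<eta> \<in> U"
  shows "\<exists>s>0. \<forall>r<s. ellipsoid k \<eta> r \<subseteq> U"
proof -
  obtain e where e: "0 < e" "ball \<eta> e \<subseteq> U"
    using assms open_contains_ball by blast
  let ?C = "\<Sum>j\<in>UNIV. 2 ^ k j :: real"
  have C: "0 < ?C"
    by (intro sum_pos) auto
  have "ellipsoid k \<eta> r \<subseteq> U" if r: "r < e / ?C" for r
  proof
    fix \<zeta> assume z: "\<zeta> \<in> ellipsoid k \<eta> r"
    have "dist \<eta> \<zeta> \<le> (\<Sum>j\<in>UNIV. cmod (\<zeta> $ j - \<eta> $ j))"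
      unfolding dist_norm norm_vec_def
      by (rule order_trans[OF L2_set_le_sum]) (auto simp: norm_minus_commute)
    also have "\<dots> \<le> ?C * r"
      unfolding sum_distrib_right using ellipsoid_coordinate[OF z] by (intro sum_mono)
    also have "\<dots> < e"
      using r C by (simp add: field_simps)
    finally show "\<zeta> \<in> U"
      using e by auto
  qed
  then show ?thesis
    using e C by (intro exI[of _ "e / ?C"]) auto
qed

lemma emeasure_haar_torus_ellipsoid:
  fixes \<eta> :: "complex ^ 'n::finite"
  assumes "\<eta> \<in> torus" "0 \<le> r"
  shows "emeasure haar_torus (ellipsoid k \<eta> r \<inter> torus) \<le> ennreal (\<Prod>j\<in>UNIV. 2 ^ k j * r)"
proof -
  have "closed {\<zeta> :: complex ^ 'n. \<forall>j. cmod (\<zeta> $ j - \<eta> $ j) \<le> 2 ^ k j * r}"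
    by (intro closed_Collect_all closed_Collect_le continuous_intros)
  then have "{\<zeta> \<in> torus. \<forall>j. cmod (\<zeta> $ j - \<eta> $ j) \<le> 2 ^ k j * r} \<in> sets haar_torus"
    unfolding sets_haar_torus sets_restrict_space
    by (auto intro!: image_eqI[of _ _ "{\<zeta>. \<forall>j. cmod (\<zeta> $ j - \<eta> $ j) \<le> 2 ^ k j * r}"])
  then have "emeasure haar_torus (ellipsoid k \<eta> r \<inter> torus)
      \<le> emeasure haar_torus {\<zeta> \<in> torus. \<forall>j. cmod (\<zeta> $ j - \<eta> $ j) \<le> 2 ^ k j * r}"
    by (intro emeasure_mono) (auto dest: ellipsoid_coordinate)
  also have "\<dots> \<le> ennreal (\<Prod>j\<in>UNIV. 2 ^ k j * r)"
    using assms by (intro emeasure_haar_torus_arcs) auto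
  finally show ?thesis .
qed

text \<open>
  The maximal function over ellipsoids of the fixed shape \<open>k\<close> is of weak type \<open>(1, 1)\<close>, with the
  constant \<open>5\<^sup>n\<close> for every \<open>k\<close>. After rescaling, the ellipsoids are balls; by the Vitali covering
  lemma a disjoint subfamily, enlarged five times, still covers the centres. The measure \<open>N\<close> of the
  disjoint ellipsoids adds up to at most that of \<open>U\<close>. Restricting to ellipsoids inside \<open>U\<close> replaces
  restricting \<open>N\<close> to \<open>U\<close>.
\<close>

lemma ellipsoid_maximal_inequality:
  fixes N :: "(complex ^ 'n::finite) measure" and k :: "'n \<Rightarrow> nat"
  assumes fin: "finite_measure N" and sets: "sets N = sets borel"
    and U: "U \<in> sets borel" and \<kappa>: "0 < \<kappa>"
  shows "\<exists>V\<in>sets haar_torus.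
    {\<eta> \<in> torus. \<exists>r. 0 < r \<and> r \<le> 1 \<and> ellipsoid k \<eta> r \<subseteq> U \<and>
      \<kappa> * (\<Prod>j\<in>UNIV. 2 ^ k j * r) \<le> measure N (ellipsoid k \<eta> r)} \<subseteq> V \<and>
    emeasure haar_torus V \<le> ennreal (5 ^ CARD('n) / \<kappa> * measure N U)"
proof -
  interpret N: finite_measure N by fact
  let ?P = "\<lambda>\<eta> r. 0 < r \<and> r \<le> 1 \<and> ellipsoid k \<eta> r \<subseteq> U \<and>
      \<kappa> * (\<Prod>j\<in>UNIV. 2 ^ k j * r) \<le> measure N (ellipsoid k \<eta> r)"
  let ?S = "{\<eta> \<in> torus. \<exists>r. ?P \<eta> r}"
  define R where "R \<eta> = (SOME r. ?P \<eta> r)" for \<eta>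
  have R: "?P \<eta> (R \<eta>)" if "\<eta> \<in> ?S" for \<eta>
    unfolding R_def using that by (intro someI_ex[of "?P \<eta>"]) auto
  have ell: "ellipsoid k \<eta> r = rescale k -` cball (rescale k \<eta>) r" for \<eta> r
    by (auto simp: ellipsoid_def)
  obtain C where C: "countable C" "C \<subseteq> ?S"
      "pairwise (\<lambda>i j. disjnt (cball (rescale k i) (R i)) (cball (rescale k j) (R j))) C"
      "rescale k ` ?S \<subseteq> (\<Union>i\<in>C. cball (rescale k i) (5 * R i))"
  proof (rule Vitali_covering_lemma_cballs[where S = "rescale k ` ?S" and K = ?S and a = "rescale k" and r = R and B = 1])
    show "rescale k ` ?S \<subseteq> (\<Union>i\<in>?S. cball (rescale k i) (R i))"
      using R by (force intro: less_imp_le)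
  qed (use R in auto)
  (* The sums of measures below run over nat, so the countable family is listed by its index set. *)
  define I where "I = to_nat_on C ` C"
  have g: "from_nat_into C i \<in> C" if "i \<in> I" for i
    using that C(1) by (auto simp: I_def)
  have inj: "from_nat_into C i \<noteq> from_nat_into C j" if "i \<in> I" "j \<in> I" "i \<noteq> j" for i j
    using that C(1) by (auto simp: I_def)
  let ?W = "\<lambda>i. if i \<in> I then ellipsoid k (from_nat_into C i) (R (from_nat_into C i)) else {}"
  let ?V = "\<lambda>i. if i \<in> I then ellipsoid k (from_nat_into C i) (5 * R (from_nat_into C i)) \<inter> torus else {}"
  have V: "?V i \<in> sets haar_torus" for i
    unfolding sets_haar_torus sets_restrict_space by auto
  have W: "?W i \<subseteq> U" for i
    using R[of "from_nat_into C i"] g[of i] C(2) by auto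
  have disj: "disjoint_family ?W"
    unfolding disjoint_family_on_def
  proof (intro ballI impI)
    fix i j :: nat assume "i \<noteq> j"
    have "cball (rescale k (from_nat_into C i)) (R (from_nat_into C i)) \<inter>
        cball (rescale k (from_nat_into C j)) (R (from_nat_into C j)) = {}" if "i \<in> I" "j \<in> I"
      using C(3) g[OF that(1)] g[OF that(2)] inj[OF that \<open>i \<noteq> j\<close>]
      unfolding pairwise_def disjnt_def by blast
    then show "?W i \<inter> ?W j = {}"
      unfolding ell by auto
  qed
  have le: "emeasure haar_torus (?V i) \<le> ennreal (5 ^ CARD('n) / \<kappa>) * emeasure N (?W i)" for i
  proof (cases "i \<in> I")
    case True
    let ?\<eta> = "from_nat_into C i"
    have \<eta>: "?\<eta> \<in> ?S"
      using g[OF True] C(2) by blast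
    note R = R[OF \<eta>]
    have "emeasure haar_torus (?V i) \<le> ennreal (\<Prod>j\<in>UNIV. 2 ^ k j * (5 * R ?\<eta>))"
      using True \<eta> R by (auto intro!: emeasure_haar_torus_ellipsoid)
    also have "(\<Prod>j\<in>UNIV. 2 ^ k j * (5 * R ?\<eta>)) = 5 ^ CARD('n) / \<kappa> * (\<kappa> * (\<Prod>j\<in>UNIV. 2 ^ k j * R ?\<eta>))"
      using \<kappa> by (simp add: prod.distrib power_mult_distrib)
    also have "ennreal \<dots> \<le> ennreal (5 ^ CARD('n) / \<kappa> * measure N (ellipsoid k ?\<eta> (R ?\<eta>)))"
      using R \<kappa> by (intro ennreal_leI mult_left_mono) auto
    also have "\<dots> = ennreal (5 ^ CARD('n) / \<kappa>) * emeasure N (?W i)"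
      using True \<kappa> by (simp add: N.emeasure_eq_measure flip: ennreal_mult)
    finally show ?thesis .
  qed simp
  show ?thesis
  proof (intro bexI[of _ "\<Union>i. ?V i"] conjI)
    show "(\<Union>i. ?V i) \<in> sets haar_torus"
      by (intro sets.countable_UN) (use V in blast)
    show "?S \<subseteq> (\<Union>i. ?V i)"
    proof
      fix \<eta> assume \<eta>: "\<eta> \<in> ?S"
      then obtain c where c: "c \<in> C" "\<eta> \<in> ellipsoid k c (5 * R c)"
        using C(4) unfolding ell by blast
      then have "\<eta> \<in> ?V (to_nat_on C c)"
        using \<eta> C(1) by (auto simp: I_def)
      then show "\<eta> \<in> (\<Union>i. ?V i)"
        by blast
    qed
    have "emeasure haar_torus (\<Union>i. ?V i) \<le> (\<Sum>i. emeasure haar_torus (?V i))"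
      by (intro emeasure_subadditive_countably image_subsetI V)
    also have "\<dots> \<le> (\<Sum>i. ennreal (5 ^ CARD('n) / \<kappa>) * emeasure N (?W i))"
      by (intro suminf_le le) auto
    also have "\<dots> = ennreal (5 ^ CARD('n) / \<kappa>) * (\<Sum>i. emeasure N (?W i))"
      by (rule ennreal_suminf_cmult)
    also have "(\<Sum>i. emeasure N (?W i)) = emeasure N (\<Union>i. ?W i)"
      using disj by (intro suminf_emeasure) (auto simp: sets)
    also have "\<dots> \<le> emeasure N U"
      by (intro emeasure_mono UN_least W) (simp add: sets U)
    also have "ennreal (5 ^ CARD('n) / \<kappa>) * emeasure N U = ennreal (5 ^ CARD('n) / \<kappa> * measure N U)"
      using \<kappa> by (simp add: N.emeasure_eq_measure flip: ennreal_mult)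
    finally show "emeasure haar_torus (\<Union>i. ?V i) \<le> ennreal (5 ^ CARD('n) / \<kappa> * measure N U)"
      by (simp add: mult_left_mono)
  qed
qed

section \<open>Ellipsoids of all shapes at a typical point\<close>

lemma summable_prod_powers:
  fixes e :: "nat \<Rightarrow> ('n::finite \<Rightarrow> nat)" and q :: real
  assumes e: "inj e" and q: "0 \<le> q" "q < 1"
  shows "summable (\<lambda>i. \<Prod>j\<in>UNIV. q ^ e i j)"
proof (rule summableI_nonneg_bounded)
  fix m :: nat
  (* Finitely many indices lie in a cube, over which the sum is a product of geometric sums. *)
  define L where "L = Suc (Max (insert 0 ((\<lambda>(i, j). e i j) ` ({..<m} \<times> UNIV))))"
  have L: "e i j < L" if "i < m" for i j
    unfolding L_def less_Suc_eq_le using that by (intro Max_ge) auto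
  have "(\<Sum>i<m. \<Prod>j\<in>UNIV. q ^ e i j) = (\<Sum>k\<in>e ` {..<m}. \<Prod>j\<in>UNIV. q ^ k j)"
    using e by (subst sum.reindex) (auto intro: inj_on_subset)
  also have "\<dots> \<le> (\<Sum>k\<in>PiE (UNIV :: 'n set) (\<lambda>_. {..<L}). \<Prod>j\<in>UNIV. q ^ k j)"
    using q L by (intro sum_mono2 finite_PiE) (auto intro: prod_nonneg)
  also have "\<dots> = (\<Prod>j\<in>(UNIV :: 'n set). \<Sum>l<L. q ^ l)"
    by (subst prod_sum_PiE) auto
  also have "\<dots> \<le> (\<Prod>j\<in>(UNIV :: 'n set). 1 / (1 - q))"
  proof (rule prod_mono)
    have "(\<Sum>l<L. q ^ l) \<le> 1 / (1 - q)"
      using q sum_le_suminf[of "\<lambda>l. q ^ l" "{..<L}"] by (simp add: suminf_geometric summable_geometric)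
    then show "0 \<le> (\<Sum>l<L. q ^ l) \<and> (\<Sum>l<L. q ^ l) \<le> 1 / (1 - q)"
      using q by (auto intro: sum_nonneg)
  qed
  finally show "(\<Sum>i<m. \<Prod>j\<in>UNIV. q ^ e i j) \<le> (\<Prod>j\<in>(UNIV :: 'n set). 1 / (1 - q))" .
qed (use q in \<open>auto intro: prod_nonneg\<close>)

text \<open>
  The shapes of the ellipsoids are listed by \<open>e\<close>. Applying the maximal inequality to the shape \<open>k\<close> at
  the level \<open>c \<Prod>\<^sub>j a\<^bsup>k j\<^esup>\<close> gives an exceptional set of measure at most a constant times
  \<open>c\<^sup>-\<^sup>1 \<Prod>\<^sub>j a\<^bsup>- k j\<^esup>\<close>, and these bounds have a finite sum over all shapes. Thus at almost every point
  the maximal functions of the different shapes grow at most like \<open>\<Prod>\<^sub>j a\<^bsup>k j\<^esup>\<close>, with \<open>a\<close> as close to 1 as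
  desired.
\<close>

lemma AE_ellipsoid_growth:
  fixes N :: "(complex ^ 'n::finite) measure" and e :: "nat \<Rightarrow> ('n \<Rightarrow> nat)"
  assumes fin: "finite_measure N" and sets: "sets N = sets borel"
    and a: "1 < a" and e: "inj e"
  shows "AE \<eta> in haar_torus. \<exists>c. \<forall>i r. 0 < r \<longrightarrow> r \<le> 1 \<longrightarrow>
    measure N (ellipsoid (e i) \<eta> r) \<le> c * (\<Prod>j\<in>UNIV. (2 * a) ^ e i j * r)"
proof (rule AE_I_outer_measure)
  fix \<epsilon> :: real assume \<epsilon>: "0 < \<epsilon>"
  interpret N: finite_measure N by fact
  let ?w = "\<lambda>i. \<Prod>j\<in>UNIV. (1 / a) ^ e i j"
  have sm: "summable ?w"
    using a by (intro summable_prod_powers e) auto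
  define T where "T = (\<Sum>i. ?w i)"
  have T: "0 \<le> T"
    unfolding T_def using a by (intro suminf_nonneg sm prod_nonneg) auto
  define c where "c = (5 ^ CARD('n) * measure N UNIV * T + 1) / \<epsilon>"
  have c: "0 < c" "5 ^ CARD('n) * measure N UNIV * T / c \<le> \<epsilon>"
  proof -
    have D: "0 \<le> 5 ^ CARD('n) * measure N UNIV * T"
      using T by simp
    then show "0 < c"
      unfolding c_def using \<epsilon> by (intro divide_pos_pos) linarith+
    show "5 ^ CARD('n) * measure N UNIV * T / c \<le> \<epsilon>"
      unfolding c_def using D \<epsilon> by (simp add: field_simps)
  qed
  define S where "S i = {\<eta> \<in> torus. \<exists>r. 0 < r \<and> r \<le> 1 \<and> ellipsoid (e i) \<eta> r \<subseteq> UNIV \<and>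
      (c / ?w i) * (\<Prod>j\<in>UNIV. 2 ^ e i j * r) \<le> measure N (ellipsoid (e i) \<eta> r)}" for i
  have w: "0 < ?w i" for i
    using a by (intro prod_pos) auto
  have "\<exists>V\<in>sets haar_torus. S i \<subseteq> V \<and>
      emeasure haar_torus V \<le> ennreal (5 ^ CARD('n) / (c / ?w i) * measure N UNIV)" for i
    unfolding S_def
    by (rule ellipsoid_maximal_inequality[OF fin sets]) (simp, rule divide_pos_pos[OF c(1) w])
  then obtain V where V: "\<And>i. V i \<in> sets haar_torus" "\<And>i. S i \<subseteq> V i"
      "\<And>i. emeasure haar_torus (V i) \<le> ennreal (5 ^ CARD('n) / (c / ?w i) * measure N UNIV)"
    by metis
  show "\<exists>V\<in>sets haar_torus. {\<eta> \<in> space haar_torus. \<not> (\<exists>c. \<forall>i r. 0 < r \<longrightarrow> r \<le> 1 \<longrightarrow>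
      measure N (ellipsoid (e i) \<eta> r) \<le> c * (\<Prod>j\<in>UNIV. (2 * a) ^ e i j * r))} \<subseteq> V \<and>
      emeasure haar_torus V \<le> ennreal \<epsilon>"
  proof (intro bexI[of _ "\<Union>i. V i"] conjI subsetI)
    show "(\<Union>i. V i) \<in> sets haar_torus"
      using V(1) by auto
    fix \<eta> :: "complex ^ 'n"
    assume "\<eta> \<in> {\<eta> \<in> space haar_torus. \<not> (\<exists>c. \<forall>i r. 0 < r \<longrightarrow> r \<le> 1 \<longrightarrow>
      measure N (ellipsoid (e i) \<eta> r) \<le> c * (\<Prod>j\<in>UNIV. (2 * a) ^ e i j * r))}"
    then obtain i r where ir: "\<eta> \<in> torus" "0 < r" "r \<le> 1"
        "\<not> measure N (ellipsoid (e i) \<eta> r) \<le> c * (\<Prod>j\<in>UNIV. (2 * a) ^ e i j * r)"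
      unfolding mem_Collect_eq space_haar_torus by blast
    have "(c / ?w i) * (\<Prod>j\<in>UNIV. 2 ^ e i j * r) = c * (\<Prod>j\<in>UNIV. (2 * a) ^ e i j * r)"
      using a by (simp add: prod.distrib power_mult_distrib prod_dividef power_one_over)
    then have "\<eta> \<in> S i"
      unfolding S_def using ir by auto
    then show "\<eta> \<in> (\<Union>i. V i)"
      using V(2) by auto
  next
    have sm': "summable (\<lambda>i. 5 ^ CARD('n) * measure N UNIV / c * ?w i)"
      by (intro summable_mult sm)
    have "emeasure haar_torus (\<Union>i. V i) \<le> (\<Sum>i. emeasure haar_torus (V i))"
      using V(1) by (intro emeasure_subadditive_countably) auto
    also have "\<dots> \<le> (\<Sum>i. ennreal (5 ^ CARD('n) * measure N UNIV / c * ?w i))"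
      using V(3) by (intro suminf_le) (auto simp: field_simps)
    also have "\<dots> = ennreal (\<Sum>i. 5 ^ CARD('n) * measure N UNIV / c * ?w i)"
      using c w by (intro suminf_ennreal2 sm' mult_nonneg_nonneg) (auto simp: less_imp_le)
    also have "(\<Sum>i. 5 ^ CARD('n) * measure N UNIV / c * ?w i) = 5 ^ CARD('n) * measure N UNIV / c * T"
      unfolding T_def by (rule suminf_mult[OF sm])
    also have "ennreal \<dots> \<le> ennreal \<epsilon>"
      using c by (intro ennreal_leI) simp
    finally show "emeasure haar_torus (\<Union>i. V i) \<le> ennreal \<epsilon>" .
  qed
qed

text \<open>
  For one shape this is the classical theorem that a singular measure has density zero almost
  everywhere. The complement of the null carrier \<open>E\<close> has an open neighbourhood \<open>U\<close> with \<open>N U\<close> as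
  small as desired. Around a point outside \<open>E\<close>, all small ellipsoids lie in \<open>U\<close>, and the maximal
  inequality relative to \<open>U\<close> bounds the set where the upper density exceeds a given level.
\<close>

lemma AE_ellipsoid_density_zero:
  fixes N :: "(complex ^ 'n::finite) measure" and k :: "'n \<Rightarrow> nat"
  assumes fin: "finite_measure N" and sets: "sets N = sets borel"
    and E: "E \<in> sets haar_torus" "emeasure haar_torus E = 0" "emeasure N (- E) = 0"
  shows "AE \<eta> in haar_torus. ((\<lambda>r. measure N (ellipsoid k \<eta> r) / r ^ CARD('n)) \<longlongrightarrow> 0) (at_right 0)"
proof -
  interpret N: finite_measure N by fact
  note Eb = borel_if_sets_haar_torus[OF E(1)]
  have Q: "0 < (\<Prod>j\<in>UNIV. 2 ^ k j :: real)"
    by (intro prod_pos) auto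
  have level: "AE \<eta> in haar_torus. \<eta> \<notin> E \<longrightarrow>
      eventually (\<lambda>r. measure N (ellipsoid k \<eta> r) / r ^ CARD('n) < \<delta>) (at_right 0)"
    if \<delta>: "0 < \<delta>" for \<delta> :: real
  proof (rule AE_I_outer_measure)
    fix \<epsilon> :: real assume \<epsilon>: "0 < \<epsilon>"
    define \<kappa> where "\<kappa> = \<delta> / (\<Prod>j\<in>UNIV. 2 ^ k j)"
    have \<kappa>: "0 < \<kappa>"
      using \<delta> Q by (simp add: \<kappa>_def)
    have "(INF U \<in> {U. - E \<subseteq> U \<and> open U}. emeasure N U) < ennreal (\<epsilon> * \<kappa> / 5 ^ CARD('n))"
      using Eb \<epsilon> \<kappa> E(3) sets outer_regular[OF sets, of "- E"] by (simp add: sets_eq_imp_space_eq)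
    then obtain U where U: "- E \<subseteq> U" "open U" "emeasure N U < ennreal (\<epsilon> * \<kappa> / 5 ^ CARD('n))"
      by (auto simp: INF_less_iff)
    obtain V where V: "V \<in> sets haar_torus"
        "{\<eta> \<in> torus. \<exists>r. 0 < r \<and> r \<le> 1 \<and> ellipsoid k \<eta> r \<subseteq> U \<and>
          \<kappa> * (\<Prod>j\<in>UNIV. 2 ^ k j * r) \<le> measure N (ellipsoid k \<eta> r)} \<subseteq> V"
        "emeasure haar_torus V \<le> ennreal (5 ^ CARD('n) / \<kappa> * measure N U)"
      using ellipsoid_maximal_inequality[OF fin sets borel_open[OF U(2)] \<kappa>, of k] by blast
    have "\<eta> \<in> V" if \<eta>: "\<eta> \<in> torus" "\<eta> \<notin> E"
      and ne: "\<not> eventually (\<lambda>r. measure N (ellipsoid k \<eta> r) / r ^ CARD('n) < \<delta>) (at_right 0)" for \<eta>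
    proof -
      obtain s where s: "0 < s" "\<And>r. r < s \<Longrightarrow> ellipsoid k \<eta> r \<subseteq> U"
        using ellipsoid_shrinks[OF U(2), of \<eta> k] \<eta> U(1) by blast
      have "\<exists>r>0. r < min s 1 \<and> \<not> measure N (ellipsoid k \<eta> r) / r ^ CARD('n) < \<delta>"
        using ne s(1) unfolding eventually_at_right_field by (metis min_less_iff_conj zero_less_one)
      then obtain r where r: "0 < r" "r < s" "r < 1" "\<delta> \<le> measure N (ellipsoid k \<eta> r) / r ^ CARD('n)"
        by auto
      have "\<kappa> * (\<Prod>j\<in>UNIV. 2 ^ k j * r) = \<delta> * r ^ CARD('n)"
        using Q by (simp add: prod.distrib \<kappa>_def)
      also have "\<dots> \<le> measure N (ellipsoid k \<eta> r)"
        using r by (simp add: pos_le_divide_eq)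
      finally show ?thesis
        using V(2) \<eta>(1) r s(2)[OF r(2)] by (auto intro!: exI[of _ r])
    qed
    moreover have "5 ^ CARD('n) / \<kappa> * measure N U \<le> \<epsilon>"
      using U(3) \<epsilon> \<kappa> by (simp add: N.emeasure_eq_measure ennreal_less_iff field_simps)
    ultimately show "\<exists>V\<in>sets haar_torus. {\<eta> \<in> space haar_torus. \<not> (\<eta> \<notin> E \<longrightarrow>
        eventually (\<lambda>r. measure N (ellipsoid k \<eta> r) / r ^ CARD('n) < \<delta>) (at_right 0))} \<subseteq> V \<and>
        emeasure haar_torus V \<le> ennreal \<epsilon>"
      using V(1) by (intro bexI[of _ V] conjI order_trans[OF V(3)] ennreal_leI)
        (auto simp: space_haar_torus)
  qed
  have "AE \<eta> in haar_torus. \<forall>m::nat. \<eta> \<notin> E \<longrightarrow>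
      eventually (\<lambda>r. measure N (ellipsoid k \<eta> r) / r ^ CARD('n) < inverse (real (Suc m))) (at_right 0)"
    unfolding AE_all_countable by (intro allI level) auto
  moreover have "AE \<eta> in haar_torus. \<eta> \<notin> E"
    using E by (intro AE_not_in) auto
  ultimately show ?thesis
  proof eventually_elim
    case (elim \<eta>)
    show ?case
    proof (rule order_tendstoI)
      fix x :: real assume "0 < x"
      then obtain m where "inverse (real (Suc m)) < x"
        using reals_Archimedean by blast
      moreover have "eventually (\<lambda>r. measure N (ellipsoid k \<eta> r) / r ^ CARD('n) < inverse (real (Suc m))) (at_right 0)"
        using elim by blast
      ultimately show "eventually (\<lambda>r. measure N (ellipsoid k \<eta> r) / r ^ CARD('n) < x) (at_right 0)"
        by (auto elim: eventually_mono)
    next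
      fix x :: real assume "x < 0"
      moreover have "0 \<le> measure N (ellipsoid k \<eta> r) / r ^ CARD('n)" if "0 < r" for r
        using that by simp
      ultimately show "eventually (\<lambda>r. x < measure N (ellipsoid k \<eta> r) / r ^ CARD('n)) (at_right 0)"
        unfolding eventually_at_right_field by (meson less_le_trans zero_less_one)
    qed
  qed
qed

section \<open>The dyadic majorant of the Poisson integral\<close>

text \<open>
  What is left of a Poisson integral at distance about \<open>t\<close> from \<open>\<eta>\<close> once the kernel has been replaced
  by constants on dyadic ellipsoids; \<open>q\<close> is the decay of the kernel per dyadic step in one
  coordinate.
\<close>

definition poisson_majorant :: "real \<Rightarrow> (nat \<Rightarrow> 'n \<Rightarrow> nat) \<Rightarrow> (complex ^ 'n::finite) measure \<Rightarrow> complex ^ 'n \<Rightarrow> real \<Rightarrow> real"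
where
  "poisson_majorant q e N \<eta> t =
     (\<Sum>i. (\<Prod>j\<in>UNIV. q ^ e i j) *
       (measure N (ellipsoid (e i) \<eta> (of_nat CARD('n) * t)) / t ^ CARD('n)))"

text \<open>
  Volumes double with each dyadic step, so a decay \<open>q < 1/2\<close> leaves a factor \<open>1/a\<^sup>2\<close> with \<open>a > 1\<close>. By
  the growth bound almost every point loses at most a factor \<open>a\<close> of it, and the terms are
  dominated by a convergent product of geometric series, uniformly in \<open>t\<close>. Each single term tends
  to \<open>0\<close> because the density of its shape vanishes, and Tannery's theorem applies.
\<close>

lemma AE_poisson_majorant_tendsto_0:
  fixes N :: "(complex ^ 'n::finite) measure" and e :: "nat \<Rightarrow> 'n \<Rightarrow> nat"
  assumes fin: "finite_measure N" and sets: "sets N = sets borel"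
    and E: "E \<in> sets haar_torus" "emeasure haar_torus E = 0" "emeasure N (- E) = 0"
    and q: "0 < q" "q < 1 / 2" and e: "inj e"
  shows "AE \<eta> in haar_torus.
    eventually (\<lambda>t. summable (\<lambda>i. (\<Prod>j\<in>UNIV. q ^ e i j) *
       (measure N (ellipsoid (e i) \<eta> (of_nat CARD('n) * t)) / t ^ CARD('n)))) (at_right 0) \<and>
    (poisson_majorant q e N \<eta> \<longlongrightarrow> 0) (at_right 0)"
proof -
  define a where "a = sqrt (1 / (2 * q))"
  have a: "1 < a" and a2: "q = 1 / (2 * a\<^sup>2)"
    using q by (simp_all add: a_def field_simps)
  let ?n = "real CARD('n)"
  have "AE \<eta> in haar_torus. \<forall>i.
      ((\<lambda>r. measure N (ellipsoid (e i) \<eta> r) / r ^ CARD('n)) \<longlongrightarrow> 0) (at_right 0)"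
    unfolding AE_all_countable by (intro allI AE_ellipsoid_density_zero[OF fin sets E])
  with AE_ellipsoid_growth[OF fin sets a e] show ?thesis
  proof eventually_elim
    case (elim \<eta>)
    from elim(1) obtain c where c: "\<And>i r. 0 < r \<Longrightarrow> r \<le> 1 \<Longrightarrow>
        measure N (ellipsoid (e i) \<eta> r) \<le> c * (\<Prod>j\<in>UNIV. (2 * a) ^ e i j * r)"
      by blast
    let ?f = "\<lambda>i t. (\<Prod>j\<in>UNIV. q ^ e i j) *
       (measure N (ellipsoid (e i) \<eta> (?n * t)) / t ^ CARD('n))"
    let ?M = "\<lambda>i. c * ?n ^ CARD('n) * (\<Prod>j\<in>UNIV. (1 / a) ^ e i j)"
    have n: "filterlim (\<lambda>t. ?n * t) (at_right 0) (at_right 0)"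
      unfolding filterlim_at
      by (auto intro!: tendsto_eq_intros simp: eventually_at_right_field intro!: exI[of _ 1])
    have limit: "(?f i \<longlongrightarrow> 0) (at_right 0)" for i
    proof -
      have "((\<lambda>t. measure N (ellipsoid (e i) \<eta> (?n * t)) / (?n * t) ^ CARD('n)) \<longlongrightarrow> 0) (at_right 0)"
        by (rule filterlim_compose[OF spec[OF elim(2), of i] n])
      from tendsto_mult[OF tendsto_const this, of "(\<Prod>j\<in>UNIV. q ^ e i j) * ?n ^ CARD('n)"]
      show ?thesis
        by (simp add: power_mult_distrib field_simps)
    qed
    have "norm (?f i t) \<le> ?M i" if t: "0 < t" "t < 1 / ?n" for i t
    proof -
      have "measure N (ellipsoid (e i) \<eta> (?n * t)) \<le> c * (\<Prod>j\<in>UNIV. (2 * a) ^ e i j * (?n * t))"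
        using t by (intro c) (auto simp: field_simps)
      then have "?f i t \<le> (\<Prod>j\<in>UNIV. q ^ e i j) *
          (c * (\<Prod>j\<in>UNIV. (2 * a) ^ e i j * (?n * t)) / t ^ CARD('n))"
        using q t by (intro mult_left_mono divide_right_mono prod_nonneg) auto
      also have "\<dots> = c * ?n ^ CARD('n) * ((\<Prod>j\<in>UNIV. q ^ e i j) * (\<Prod>j\<in>UNIV. (2 * a) ^ e i j))"
        using t by (simp add: prod.distrib power_mult_distrib)
      also have "(\<Prod>j\<in>UNIV. q ^ e i j) * (\<Prod>j\<in>UNIV. (2 * a) ^ e i j) = (\<Prod>j\<in>UNIV. (1 / a) ^ e i j)"
        unfolding a2 using a unfolding prod.distrib[symmetric] power_mult_distrib[symmetric]
        by (simp add: power2_eq_square)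
      finally have "?f i t \<le> ?M i" .
      moreover have "0 \<le> ?f i t"
        using q t by (intro mult_nonneg_nonneg prod_nonneg) auto
      ultimately show ?thesis
        by simp
    qed
    then have ev: "eventually (\<lambda>t. \<forall>i. norm (?f i t) \<le> ?M i) (at_right 0)"
      unfolding eventually_at_right_field by (intro exI[of _ "1 / ?n"]) auto
    have bound: "eventually (\<lambda>(i, t). norm (?f i t) \<le> ?M i) (at_top \<times>\<^sub>F at_right 0)"
      unfolding eventually_prod_filter using ev
      by (intro exI[of _ "\<lambda>_. True"] exI[of _ "\<lambda>t. \<forall>i. norm (?f i t) \<le> ?M i"]) simp
    have "summable ?M"
      using a by (intro summable_mult summable_prod_powers e) auto
    from tannerys_theorem[OF limit bound this]
    have "eventually (\<lambda>t. summable (\<lambda>i. norm (?f i t))) (at_right 0)"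
      and "((\<lambda>t. \<Sum>i. ?f i t) \<longlongrightarrow> (\<Sum>i. 0)) (at_right 0)"
      by (simp_all add: trivial_limit_at_right_real)
    then show ?case
      unfolding poisson_majorant_def
      by (auto elim!: eventually_mono intro: summable_norm_cancel)
  qed
qed

section \<open>Bounds for the kernel in a restricted Stolz region\<close>

lemma cmod_powr_ge:
  assumes "w \<noteq> 0"
  shows "cmod w powr Re c * exp (- pi * \<bar>Im c\<bar>) \<le> cmod (w powr c)"
proof -
  have "\<bar>Im c * Im (Ln w)\<bar> \<le> \<bar>Im c\<bar> * pi"
    unfolding abs_mult using mpi_less_Im_Ln[OF assms] Im_Ln_le_pi[OF assms]
    by (intro mult_left_mono) (auto simp: abs_le_iff)
  then have "Re c * ln (cmod w) + (- pi * \<bar>Im c\<bar>) \<le> Re (c * Ln w)"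
    using assms by (simp add: abs_le_iff algebra_simps)
  then show ?thesis
    using assms by (simp add: powr_def flip: exp_add)
qed

text \<open>
  Both \<open>1 - z \<zeta>\<^sup>*\<close> and its conjugate have modulus \<open>|z - \<zeta>|\<close> on the circle, and the imaginary parts of
  the exponents contribute only bounded factors, because arguments are bounded by \<open>\<pi>\<close>. The factor
  is thus at most a constant times a classical kernel with real exponents.
\<close>

lemma cmod_poisson_factor_le:
  fixes a b z \<zeta> :: complex
  assumes \<zeta>: "cmod \<zeta> = 1" and z: "cmod z < 1"
  shows "cmod (poisson_const a b * (of_real (1 - (cmod z)\<^sup>2) powr (a + b + 1) /
      ((1 - z * cnj \<zeta>) powr (a + 1) * (1 - cnj z * \<zeta>) powr (b + 1))))
    \<le> cmod (poisson_const a b) * exp (pi * (\<bar>Im a\<bar> + \<bar>Im b\<bar>)) *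
       ((1 - (cmod z)\<^sup>2) powr (Re a + Re b + 1) / cmod (z - \<zeta>) powr (Re a + Re b + 2))"
proof -
  let ?d = "cmod (z - \<zeta>)"
  have "z \<noteq> \<zeta>"
    using assms by auto
  have "1 - z * cnj \<zeta> = (\<zeta> - z) * cnj \<zeta>"
    using \<zeta> complex_norm_square[of \<zeta>] by (simp add: algebra_simps)
  then have 1: "cmod (1 - z * cnj \<zeta>) = ?d"
    using \<zeta> by (simp add: norm_mult norm_minus_commute)
  have "1 - cnj z * \<zeta> = cnj (1 - z * cnj \<zeta>)"
    by simp
  then have 2: "cmod (1 - cnj z * \<zeta>) = ?d"
    unfolding 1[symmetric] by (metis complex_mod_cnj)
  have nz: "1 - z * cnj \<zeta> \<noteq> 0" "1 - cnj z * \<zeta> \<noteq> 0"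
    using 1 2 \<open>z \<noteq> \<zeta>\<close> by (metis norm_zero right_minus_eq norm_eq_zero)+
  have z2: "0 \<le> 1 - (cmod z)\<^sup>2"
    using z by (simp add: power_le_one)
  have "?d powr (Re a + 1) * exp (- pi * \<bar>Im a\<bar>) \<le> cmod ((1 - z * cnj \<zeta>) powr (a + 1))"
    using cmod_powr_ge[OF nz(1), of "a + 1"] by (simp add: 1)
  moreover have "?d powr (Re b + 1) * exp (- pi * \<bar>Im b\<bar>) \<le> cmod ((1 - cnj z * \<zeta>) powr (b + 1))"
    using cmod_powr_ge[OF nz(2), of "b + 1"] by (simp add: 2)
  ultimately have "(?d powr (Re a + 1) * exp (- pi * \<bar>Im a\<bar>)) * (?d powr (Re b + 1) * exp (- pi * \<bar>Im b\<bar>))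
      \<le> cmod ((1 - z * cnj \<zeta>) powr (a + 1)) * cmod ((1 - cnj z * \<zeta>) powr (b + 1))"
    by (intro mult_mono) auto
  moreover have "(?d powr (Re a + 1) * exp (- pi * \<bar>Im a\<bar>)) * (?d powr (Re b + 1) * exp (- pi * \<bar>Im b\<bar>))
      = ?d powr (Re a + Re b + 2) / exp (pi * (\<bar>Im a\<bar> + \<bar>Im b\<bar>))"
  proof -
    have "?d powr (Re a + 1) * ?d powr (Re b + 1) = ?d powr (Re a + Re b + 2)"
      by (simp add: algebra_simps flip: powr_add)
    moreover have "exp (- pi * \<bar>Im a\<bar>) * exp (- pi * \<bar>Im b\<bar>) = 1 / exp (pi * (\<bar>Im a\<bar> + \<bar>Im b\<bar>))"
      by (simp add: exp_minus exp_add inverse_eq_divide algebra_simps)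
    ultimately show ?thesis
      by (simp add: field_simps)
  qed
  moreover have pos: "0 < ?d powr (Re a + Re b + 2) / exp (pi * (\<bar>Im a\<bar> + \<bar>Im b\<bar>))"
    using \<open>z \<noteq> \<zeta>\<close> by simp
  ultimately have le: "?d powr (Re a + Re b + 2) / exp (pi * (\<bar>Im a\<bar> + \<bar>Im b\<bar>))
      \<le> cmod ((1 - z * cnj \<zeta>) powr (a + 1)) * cmod ((1 - cnj z * \<zeta>) powr (b + 1))"
    by simp
  have num: "cmod (of_real (1 - (cmod z)\<^sup>2) powr (a + b + 1)) = (1 - (cmod z)\<^sup>2) powr (Re a + Re b + 1)"
    using z2 by (subst norm_powr_real_powr) auto
  have "cmod (poisson_const a b) * ((1 - (cmod z)\<^sup>2) powr (Re a + Re b + 1) /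
      (cmod ((1 - z * cnj \<zeta>) powr (a + 1)) * cmod ((1 - cnj z * \<zeta>) powr (b + 1))))
    \<le> cmod (poisson_const a b) * ((1 - (cmod z)\<^sup>2) powr (Re a + Re b + 1) /
      (?d powr (Re a + Re b + 2) / exp (pi * (\<bar>Im a\<bar> + \<bar>Im b\<bar>))))"
    by (intro mult_left_mono divide_left_mono le mult_pos_pos pos less_le_trans[OF pos le]) auto
  then show ?thesis
    unfolding norm_mult norm_divide num by (simp add: mult_ac)
qed

lemma stolz_distance:
  assumes \<eta>: "cmod \<eta> = 1" and z: "z \<in> stolz A \<eta>"
  shows "cmod z < 1" and "cmod (z - \<eta>) \<le> (1 + A) * (1 - cmod z)"
proof -
  obtain r \<theta> where r: "z = of_real r * (\<eta> * cis (- \<theta>))" "0 \<le> r" "r < 1" "\<bar>\<theta>\<bar> \<le> A * (1 - r)"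
    using z unfolding stolz_def by blast
  have zr: "cmod z = r"
    using r \<eta> by (simp add: norm_mult)
  then show "cmod z < 1"
    using r by simp
  have "z - \<eta> = \<eta> * (of_real (r - 1) * cis (- \<theta>) + (cis (- \<theta>) - cis 0))"
    using r(1) by (simp add: algebra_simps)
  then have "cmod (z - \<eta>) = cmod (of_real (r - 1) * cis (- \<theta>) + (cis (- \<theta>) - cis 0))"
    using \<eta> by (simp add: norm_mult)
  also have "\<dots> \<le> cmod (of_real (r - 1) * cis (- \<theta>)) + cmod (cis (- \<theta>) - cis 0)"
    by (rule norm_triangle_ineq)
  also have "cmod (of_real (r - 1) * cis (- \<theta>)) = 1 - r"
    using r by (simp only: norm_mult norm_of_real) simp
  also have "cmod (cis (- \<theta>) - cis 0) \<le> \<bar>\<theta>\<bar>"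
    unfolding dist_cis using abs_sin_x_le_abs_x[of "(- \<theta> - 0) / 2"] by simp
  finally show "cmod (z - \<eta>) \<le> (1 + A) * (1 - cmod z)"
    using r zr by (simp add: algebra_simps)
qed

text \<open>
  For \<open>z\<close> in a Stolz region at \<open>\<eta>\<close> and \<open>1 - |z|\<close> comparable to \<open>t\<close>, the distance \<open>|z - \<zeta>|\<close> is
  bounded below by a multiple of both \<open>t\<close> and \<open>|\<zeta> - \<eta>|\<close>.
\<close>

lemma poisson_factor_ratio_le:
  fixes z \<eta> \<zeta> :: complex
  assumes "cmod \<eta> = 1" "cmod \<zeta> = 1" and z: "z \<in> stolz A \<eta>" and A: "0 < A" and B: "1 \<le> B"
    and t: "0 < t" "t / B \<le> 1 - cmod z" "1 - cmod z \<le> B * t"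
    and s: "0 < \<sigma>" "\<sigma> \<le> s"
  shows "(1 - (cmod z)\<^sup>2) powr s / cmod (z - \<zeta>) powr (s + 1)
    \<le> (2 * B) powr s * (B * (2 + A)) powr (s + 1) * (max 1 (cmod (\<zeta> - \<eta>) / t) powr - (1 + \<sigma>) / t)"
proof -
  note sd = stolz_distance[OF assms(1) z]
  define m where "m = max 1 (cmod (\<zeta> - \<eta>) / t)"
  have m: "1 \<le> m"
    by (simp add: m_def)
  define D where "D = B * (2 + A)"
  have D: "0 < D"
    using A B by (simp add: D_def)
  have ge: "1 - cmod z \<le> cmod (z - \<zeta>)"
    using norm_triangle_ineq2[of \<zeta> z] assms(2) by (simp add: norm_minus_commute)
  have "cmod (\<zeta> - \<eta>) \<le> cmod (z - \<zeta>) + cmod (z - \<eta>)"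
    using norm_triangle_ineq[of "\<zeta> - z" "z - \<eta>"] by (simp add: norm_minus_commute)
  also have "\<dots> \<le> cmod (z - \<zeta>) + (1 + A) * cmod (z - \<zeta>)"
    using sd(2) ge A by (intro add_mono order_refl order_trans[OF sd(2)] mult_left_mono) auto
  finally have 1: "cmod (\<zeta> - \<eta>) \<le> (2 + A) * cmod (z - \<zeta>)"
    by (simp add: algebra_simps)
  also have "\<dots> \<le> B * ((2 + A) * cmod (z - \<zeta>))"
    using A B mult_right_mono[of 1 B "(2 + A) * cmod (z - \<zeta>)"] by simp
  finally have 2: "cmod (\<zeta> - \<eta>) \<le> D * cmod (z - \<zeta>)"
    by (simp add: D_def mult_ac)
  have "t \<le> B * cmod (z - \<zeta>)"
  proof -
    have "t \<le> B * (1 - cmod z)"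
      using t(2) B by (simp add: field_simps)
    also have "\<dots> \<le> B * cmod (z - \<zeta>)"
      using ge B by (intro mult_left_mono) auto
    finally show ?thesis .
  qed
  also have "\<dots> \<le> D * cmod (z - \<zeta>)"
    using A B by (intro mult_right_mono) (auto simp: D_def algebra_simps)
  finally have "t * m \<le> D * cmod (z - \<zeta>)"
    using 2 t(1) by (auto simp: m_def max_def)
  then have low: "t * m / D \<le> cmod (z - \<zeta>)"
    using D by (simp add: pos_divide_le_eq mult.commute)
  have z0: "0 \<le> cmod z" "cmod z < 1"
    using sd by auto
  have "1 - (cmod z)\<^sup>2 = (1 + cmod z) * (1 - cmod z)"
    by (simp add: power2_eq_square algebra_simps)
  also have "\<dots> \<le> 2 * (B * t)"
    using z0 t by (intro mult_mono) auto
  finally have up: "1 - (cmod z)\<^sup>2 \<le> 2 * B * t"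
    by simp
  have "(1 - (cmod z)\<^sup>2) powr s / cmod (z - \<zeta>) powr (s + 1)
      \<le> (2 * B * t) powr s / (t * m / D) powr (s + 1)"
    using up low s t m D z0
    by (intro frac_le powr_mono2) (auto simp: power_le_one)
  also have "\<dots> = (2 * B) powr s * D powr (s + 1) * (m powr - (1 + s) / t)"
  proof -
    have "(2 * B * t) powr s = (2 * B) powr s * t powr s"
      by (rule powr_mult)
    moreover have "(t * m / D) powr (s + 1) = t powr s * t * m powr (s + 1) / D powr (s + 1)"
      using t m D by (simp add: powr_mult powr_divide powr_add)
    moreover have "m powr - (1 + s) = 1 / m powr (s + 1)"
      by (subst powr_minus_divide) (simp add: add.commute)
    ultimately show ?thesis
      using t m D by simp
  qed
  also have "\<dots> \<le> (2 * B) powr s * D powr (s + 1) * (m powr - (1 + \<sigma>) / t)"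
    using t m s by (intro mult_left_mono divide_right_mono powr_mono) auto
  finally show ?thesis
    unfolding m_def D_def .
qed

text \<open>The least \<open>k\<close> with \<open>x \<le> 2\<^sup>k\<close> works; it is \<open>0\<close> or satisfies \<open>2\<^sup>k < 2 x\<close>.\<close>

lemma dyadic_decay:
  fixes x :: real
  assumes s: "0 < \<sigma>"
  shows "\<exists>k. x \<le> 2 ^ k \<and> max 1 x powr - (1 + \<sigma>) \<le> 2 powr (1 + \<sigma>) * (1 / 2 powr (1 + \<sigma>)) ^ k"
proof -
  define k where "k = (LEAST k::nat. x \<le> 2 ^ k)"
  have ex: "\<exists>k::nat. x \<le> 2 ^ k"
    using real_arch_pow[of 2 x] by (auto intro: less_imp_le)
  have k: "x \<le> 2 ^ k"
    unfolding k_def using ex by (rule LeastI_ex)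
  have "max 1 x powr - (1 + \<sigma>) \<le> 2 powr (1 + \<sigma>) * (1 / 2 powr (1 + \<sigma>)) ^ k"
  proof (cases k)
    case 0
    have "max 1 x powr - (1 + \<sigma>) \<le> max 1 x powr 0"
      using s by (intro powr_mono) auto
    also have "\<dots> \<le> 2 powr (1 + \<sigma>)"
      using s by (simp add: ge_one_powr_ge_zero)
    finally show ?thesis
      using 0 by simp
  next
    case (Suc l)
    have "\<not> x \<le> 2 ^ l"
      using not_less_Least[of l "\<lambda>k. x \<le> 2 ^ k"] Suc by (simp add: k_def)
    then have "max 1 x powr - (1 + \<sigma>) \<le> (2 ^ l) powr - (1 + \<sigma>)"
      using s by (intro powr_mono2') auto
    also have "\<dots> = 1 / ((2 powr real l) powr (1 + \<sigma>))"
      by (subst powr_minus_divide) (simp add: powr_realpow)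
    also have "\<dots> = (1 / 2 powr (1 + \<sigma>)) ^ l"
    proof -
      have "(2 powr (1 + \<sigma>)) ^ l = (2 powr (1 + \<sigma>)) powr real l"
        by (simp add: powr_realpow)
      then show ?thesis
        by (simp only: powr_powr power_one_over mult.commute)
    qed
    finally show ?thesis
      using Suc by simp
  qed
  with k show ?thesis
    by blast
qed

text \<open>
  The constant \<open>K\<close> depends on the aperture and on the exponents only. Choosing the dyadic scale in each
  coordinate separately keeps the full decay of every factor. The size of the largest
  coordinate of \<open>\<zeta> - \<eta>\<close> alone would in general not give summable weights in several variables.
\<close>

lemma poisson_kernel_le_dyadic:
  fixes \<alpha> \<beta> :: "complex ^ 'n::finite"
  assumes A: "0 < A" and B: "1 \<le> B" and \<sigma>: "0 < \<sigma>" "\<And>j. \<sigma> \<le> Re (\<alpha> $ j) + Re (\<beta> $ j) + 1"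
  obtains K where "0 \<le> K"
    and "\<And>\<eta> \<zeta> z t. \<eta> \<in> torus \<Longrightarrow> \<zeta> \<in> torus \<Longrightarrow> 0 < t \<Longrightarrow>
      (\<And>j. z $ j \<in> stolz A (\<eta> $ j)) \<Longrightarrow>
      (\<And>j. t / B \<le> 1 - cmod (z $ j)) \<Longrightarrow> (\<And>j. 1 - cmod (z $ j) \<le> B * t) \<Longrightarrow>
      \<exists>k. \<zeta> \<in> ellipsoid k \<eta> (of_nat CARD('n) * t) \<and>
        cmod (poisson_kernel \<alpha> \<beta> z \<zeta>) \<le> K * (\<Prod>j\<in>UNIV. (1 / 2 powr (1 + \<sigma>)) ^ k j) / t ^ CARD('n)"
proof -
  let ?s = "\<lambda>j. Re (\<alpha> $ j) + Re (\<beta> $ j) + 1"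
  define C where "C j = cmod (poisson_const (\<alpha> $ j) (\<beta> $ j)) * exp (pi * (\<bar>Im (\<alpha> $ j)\<bar> + \<bar>Im (\<beta> $ j)\<bar>)) *
      ((2 * B) powr ?s j * (B * (2 + A)) powr (?s j + 1)) * 2 powr (1 + \<sigma>)" for j
  have C: "0 \<le> C j" for j
    by (simp add: C_def)
  show ?thesis
  proof (rule that[of "\<Prod>j\<in>UNIV. C j"])
    show "0 \<le> (\<Prod>j\<in>UNIV. C j)"
      by (intro prod_nonneg C)
    fix \<eta> \<zeta> z :: "complex ^ 'n" and t :: real
    assume \<eta>: "\<eta> \<in> torus" and \<zeta>: "\<zeta> \<in> torus" and t: "0 < t"
      and z: "\<And>j. z $ j \<in> stolz A (\<eta> $ j)" "\<And>j. t / B \<le> 1 - cmod (z $ j)" "\<And>j. 1 - cmod (z $ j) \<le> B * t"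
    have unit: "cmod (\<eta> $ j) = 1" "cmod (\<zeta> $ j) = 1" for j
      using \<eta> \<zeta> by (auto simp: torus_def)
    have "\<forall>j. \<exists>k. cmod (\<zeta> $ j - \<eta> $ j) / t \<le> 2 ^ k \<and>
        max 1 (cmod (\<zeta> $ j - \<eta> $ j) / t) powr - (1 + \<sigma>) \<le> 2 powr (1 + \<sigma>) * (1 / 2 powr (1 + \<sigma>)) ^ k"
      by (intro allI dyadic_decay \<sigma>(1))
    then obtain k where k: "\<And>j. cmod (\<zeta> $ j - \<eta> $ j) / t \<le> 2 ^ k j"
        "\<And>j. max 1 (cmod (\<zeta> $ j - \<eta> $ j) / t) powr - (1 + \<sigma>) \<le> 2 powr (1 + \<sigma>) * (1 / 2 powr (1 + \<sigma>)) ^ k j"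
      by metis
    have "\<zeta> \<in> ellipsoid k \<eta> (of_nat CARD('n) * t)"
      using k(1) t by (intro ellipsoid_memI) (simp add: pos_divide_le_eq)
    moreover have "cmod (poisson_kernel \<alpha> \<beta> z \<zeta>) \<le> (\<Prod>j\<in>UNIV. C j * ((1 / 2 powr (1 + \<sigma>)) ^ k j / t))"
      unfolding poisson_kernel_def prod_norm[symmetric]
    proof (intro prod_mono conjI norm_ge_zero)
      fix j
      have "cmod (poisson_const (\<alpha> $ j) (\<beta> $ j) *
          (of_real (1 - (cmod (z $ j))\<^sup>2) powr (\<alpha> $ j + \<beta> $ j + 1) /
          ((1 - z $ j * cnj (\<zeta> $ j)) powr (\<alpha> $ j + 1) * (1 - cnj (z $ j) * \<zeta> $ j) powr (\<beta> $ j + 1))))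
        \<le> cmod (poisson_const (\<alpha> $ j) (\<beta> $ j)) * exp (pi * (\<bar>Im (\<alpha> $ j)\<bar> + \<bar>Im (\<beta> $ j)\<bar>)) *
          ((1 - (cmod (z $ j))\<^sup>2) powr ?s j / cmod (z $ j - \<zeta> $ j) powr (?s j + 1))"
        using cmod_poisson_factor_le[OF unit(2)[of j] stolz_distance(1)[OF unit(1)[of j] z(1)], of "\<alpha> $ j" "\<beta> $ j"]
        by (simp add: add.assoc)
      also have "\<dots> \<le> cmod (poisson_const (\<alpha> $ j) (\<beta> $ j)) * exp (pi * (\<bar>Im (\<alpha> $ j)\<bar> + \<bar>Im (\<beta> $ j)\<bar>)) *
          ((2 * B) powr ?s j * (B * (2 + A)) powr (?s j + 1) *
            (max 1 (cmod (\<zeta> $ j - \<eta> $ j) / t) powr - (1 + \<sigma>) / t))"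
        by (intro mult_left_mono poisson_factor_ratio_le unit A B t z \<sigma>) auto
      also have "\<dots> \<le> cmod (poisson_const (\<alpha> $ j) (\<beta> $ j)) * exp (pi * (\<bar>Im (\<alpha> $ j)\<bar> + \<bar>Im (\<beta> $ j)\<bar>)) *
          ((2 * B) powr ?s j * (B * (2 + A)) powr (?s j + 1) *
            (2 powr (1 + \<sigma>) * (1 / 2 powr (1 + \<sigma>)) ^ k j / t))"
        using t by (intro mult_left_mono divide_right_mono k(2)) auto
      also have "\<dots> = C j * ((1 / 2 powr (1 + \<sigma>)) ^ k j / t)"
        by (simp add: C_def)
      finally show "cmod (poisson_const (\<alpha> $ j) (\<beta> $ j) *
          (of_real (1 - (cmod (z $ j))\<^sup>2) powr (\<alpha> $ j + \<beta> $ j + 1) /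
          ((1 - z $ j * cnj (\<zeta> $ j)) powr (\<alpha> $ j + 1) * (1 - cnj (z $ j) * \<zeta> $ j) powr (\<beta> $ j + 1))))
        \<le> C j * ((1 / 2 powr (1 + \<sigma>)) ^ k j / t)" .
    qed
    moreover have "(\<Prod>j\<in>UNIV. C j * ((1 / 2 powr (1 + \<sigma>)) ^ k j / t)) =
        (\<Prod>j\<in>UNIV. C j) * (\<Prod>j\<in>UNIV. (1 / 2 powr (1 + \<sigma>)) ^ k j) / t ^ CARD('n)"
      by (simp add: prod.distrib prod_dividef)
    ultimately show "\<exists>k. \<zeta> \<in> ellipsoid k \<eta> (of_nat CARD('n) * t) \<and>
      cmod (poisson_kernel \<alpha> \<beta> z \<zeta>) \<le> (\<Prod>j\<in>UNIV. C j) * (\<Prod>j\<in>UNIV. (1 / 2 powr (1 + \<sigma>)) ^ k j) / t ^ CARD('n)"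
      by auto
  qed
qed

text \<open>
  The modulus of \<open>f\<close> at a point is at most one term, hence at most the sum, of a series of
  multiples of indicators of ellipsoids, which is integrated term by term. A function that is not
  integrable has integral zero by convention, and then the bound is trivial.
\<close>

lemma integral_le_poisson_majorant:
  fixes M :: "(complex ^ 'n::finite) measure" and e :: "nat \<Rightarrow> 'n \<Rightarrow> nat" and f :: "complex ^ 'n \<Rightarrow> complex"
  assumes fin: "finite_measure M" and sets: "sets M = sets (restrict_space borel torus)"
    and e: "surj e" and t: "0 < t" and K: "0 \<le> K" and q: "0 \<le> q"
    and f: "\<And>\<zeta>. \<zeta> \<in> torus \<Longrightarrow> \<exists>k. \<zeta> \<in> ellipsoid k \<eta> (of_nat CARD('n) * t) \<and>
      cmod (f \<zeta>) \<le> K * (\<Prod>j\<in>UNIV. q ^ k j) / t ^ CARD('n)"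
    and sm: "summable (\<lambda>i. (\<Prod>j\<in>UNIV. q ^ e i j) *
       (measure (distr M borel (\<lambda>x. x)) (ellipsoid (e i) \<eta> (of_nat CARD('n) * t)) / t ^ CARD('n)))"
  shows "cmod (\<integral>\<zeta>. f \<zeta> \<partial>M) \<le> K * poisson_majorant q e (distr M borel (\<lambda>x. x)) \<eta> t"
proof -
  let ?N = "distr M borel (\<lambda>x. x)"
  let ?ell = "\<lambda>i. ellipsoid (e i) \<eta> (of_nat CARD('n) * t)"
  define w where "w i = (\<Prod>j\<in>UNIV. q ^ e i j)" for i
  have w: "0 \<le> w i" for i
    unfolding w_def using q by (intro prod_nonneg) auto
  have m: "(\<lambda>x. x) \<in> M \<rightarrow>\<^sub>M borel"
    unfolding measurable_cong_sets[OF sets refl] by (rule measurable_restrict_space1) simp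
  interpret M: finite_measure M by fact
  interpret N: finite_measure ?N by (rule M.finite_measure_distr[OF m])
  have space: "space M = torus"
    using sets_eq_imp_space_eq[OF sets] by (simp add: space_restrict_space)
  have sm': "summable (\<lambda>i. w i * (measure ?N (?ell i) / t ^ CARD('n)))"
    using sm by (simp add: w_def)
  have majorant: "poisson_majorant q e ?N \<eta> t = (\<Sum>i. w i * (measure ?N (?ell i) / t ^ CARD('n)))"
    by (simp add: poisson_majorant_def w_def)
  have nonneg: "0 \<le> K * poisson_majorant q e ?N \<eta> t"
    unfolding majorant using t K w by (intro mult_nonneg_nonneg suminf_nonneg sm') auto
  show ?thesis
  proof (cases "integrable M f")
    case False
    then show ?thesis
      using nonneg by (simp add: not_integrable_integral_eq)
  next
    case True
    define G where "G i \<zeta> = ennreal (K * w i / t ^ CARD('n)) * indicator (?ell i) \<zeta>" for i \<zeta>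
    have G: "G i \<in> borel_measurable borel" for i
      unfolding G_def by measurable
    let ?F = "\<lambda>\<zeta>. \<Sum>i. G i \<zeta>"
    have "ennreal (cmod (\<integral>\<zeta>. f \<zeta> \<partial>M)) \<le> (\<integral>\<^sup>+ \<zeta>. cmod (f \<zeta>) \<partial>M)"
      by (rule integral_norm_bound_ennreal[OF True])
    also have "\<dots> \<le> (\<integral>\<^sup>+ \<zeta>. ?F \<zeta> \<partial>M)"
    proof (rule nn_integral_mono)
      fix \<zeta> assume "\<zeta> \<in> space M"
      then obtain k where k: "\<zeta> \<in> ellipsoid k \<eta> (of_nat CARD('n) * t)"
          "cmod (f \<zeta>) \<le> K * (\<Prod>j\<in>UNIV. q ^ k j) / t ^ CARD('n)"
        using f space by blast
      obtain i where i: "k = e i"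
        using e by auto
      have "ennreal (cmod (f \<zeta>)) \<le> G i \<zeta>"
        using k i by (simp add: G_def w_def ennreal_leI)
      also have "\<dots> \<le> ?F \<zeta>"
        using sum_le_suminf[of "\<lambda>i. G i \<zeta>" "{i}"] by simp
      finally show "ennreal (cmod (f \<zeta>)) \<le> ?F \<zeta>" .
    qed
    also have "\<dots> = (\<integral>\<^sup>+ \<zeta>. ?F \<zeta> \<partial>?N)"
      using G by (subst nn_integral_distr[OF m]) auto
    also have "\<dots> = (\<Sum>i. \<integral>\<^sup>+ \<zeta>. G i \<zeta> \<partial>?N)"
      using G by (intro nn_integral_suminf) simp
    also have "\<dots> = (\<Sum>i. ennreal (K * (w i * (measure ?N (?ell i) / t ^ CARD('n)))))"
      unfolding G_def using w K t by (intro suminf_cong, subst nn_integral_cmult_indicator)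
        (auto simp: N.emeasure_eq_measure simp flip: ennreal_mult)
    also have "\<dots> = ennreal (\<Sum>i. K * (w i * (measure ?N (?ell i) / t ^ CARD('n))))"
      using K w t by (intro suminf_ennreal2 summable_mult sm') auto
    also have "(\<Sum>i. K * (w i * (measure ?N (?ell i) / t ^ CARD('n)))) = K * poisson_majorant q e ?N \<eta> t"
      unfolding majorant by (rule suminf_mult[OF sm'])
    finally show ?thesis
      using nonneg by simp
  qed
qed

section \<open>Restricted non-tangential limits of singular measures\<close>

lemma RNT_lim_iff_tendsto:
  "RNT_lim u \<eta> l \<longleftrightarrow>
    (\<forall>A>0. \<forall>B\<ge>1. (u \<longlongrightarrow> l) (inf (nhds \<eta>) (principal (restricted_stolz A B \<eta>))))"
  unfolding RNT_lim_def tendsto_iff eventually_inf_principal eventually_nhds_metric dist_norm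
  by (intro all_cong imp_cong refl ex_cong conj_cong) auto

lemma RNT_lim_zero_linear:
  assumes "RNT_lim u \<eta> 0" "RNT_lim v \<eta> 0"
  shows "RNT_lim (\<lambda>z. u z + c * v z) \<eta> 0"
  unfolding RNT_lim_iff_tendsto
proof (intro allI impI)
  fix A B :: real assume "0 < A" "1 \<le> B"
  with assms have "(u \<longlongrightarrow> 0) (inf (nhds \<eta>) (principal (restricted_stolz A B \<eta>)))"
    and "(v \<longlongrightarrow> 0) (inf (nhds \<eta>) (principal (restricted_stolz A B \<eta>)))"
    unfolding RNT_lim_iff_tendsto by blast+
  from tendsto_add[OF this(1) tendsto_mult_left[OF this(2), of c]]
  show "((\<lambda>z. u z + c * v z) \<longlongrightarrow> 0) (inf (nhds \<eta>) (principal (restricted_stolz A B \<eta>)))"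
    by simp
qed

lemma restricted_stolz_comparable:
  fixes \<eta> :: "complex ^ 'n::finite"
  assumes \<eta>: "\<eta> \<in> torus" and B: "1 \<le> B" and z: "z \<in> restricted_stolz A B \<eta>"
  shows "0 < 1 - cmod (z $ i)" and "1 - cmod (z $ i) \<le> norm (z - \<eta>)" and "z $ i \<in> stolz A (\<eta> $ i)"
    and "(1 - cmod (z $ i)) / B \<le> 1 - cmod (z $ j)" and "1 - cmod (z $ j) \<le> B * (1 - cmod (z $ i))"
proof -
  have unit: "cmod (\<eta> $ j) = 1" for j
    using \<eta> by (auto simp: torus_def)
  have st: "z $ j \<in> stolz A (\<eta> $ j)" for j
    using z by (auto simp: restricted_stolz_def)
  then show "z $ i \<in> stolz A (\<eta> $ i)" .
  have pos: "0 < 1 - cmod (z $ j)" for j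
    using stolz_distance(1)[OF unit st, of j] by simp
  then show "0 < 1 - cmod (z $ i)" .
  have ratio: "(1 - cmod (z $ j)) / (1 - cmod (z $ k)) \<le> B" for j k
  proof -
    have "(1 - cmod (z $ j)) / (1 - cmod (z $ k)) \<le>
        Max (range (\<lambda>(j, k). (1 - cmod (z $ j)) / (1 - cmod (z $ k))))"
      by (intro Max_ge) (auto intro: image_eqI[of _ _ "(j, k)"])
    also have "\<dots> \<le> B"
      using z by (simp add: restricted_stolz_def)
    finally show ?thesis .
  qed
  show "1 - cmod (z $ j) \<le> B * (1 - cmod (z $ i))"
    using ratio[of j i] pos[of i] by (simp add: pos_divide_le_eq)
  show "(1 - cmod (z $ i)) / B \<le> 1 - cmod (z $ j)"
    using ratio[of i j] pos[of j] B by (simp add: pos_divide_le_eq mult.commute)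
  have "1 - cmod (z $ i) \<le> cmod ((z - \<eta>) $ i)"
    using norm_triangle_ineq2[of "\<eta> $ i" "z $ i"] unit by (simp add: norm_minus_commute)
  also have "\<dots> \<le> norm (z - \<eta>)"
    by (rule Finite_Cartesian_Product.norm_nth_le)
  finally show "1 - cmod (z $ i) \<le> norm (z - \<eta>)" .
qed

text \<open>
  The good points are those where the dyadic majorant tends to zero; they depend neither on the
  aperture nor on the ratio \<open>B\<close>, which only change the constant \<open>K\<close>.
\<close>

lemma AE_RNT_lim_singular_measure:
  fixes \<alpha> \<beta> :: "complex ^ 'n::finite" and M :: "(complex ^ 'n) measure"
  assumes \<alpha>\<beta>: "\<And>j. Re (\<alpha> $ j) + Re (\<beta> $ j) > -1"
    and fin: "finite_measure M" and sets: "sets M = sets (restrict_space borel torus)"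
    and E: "E \<in> sets haar_torus" "emeasure haar_torus E = 0" "emeasure M (torus - E) = 0"
  shows "AE \<eta> in haar_torus. RNT_lim (\<lambda>z. \<integral>\<zeta>. poisson_kernel \<alpha> \<beta> z \<zeta> \<partial>M) \<eta> 0"
proof -
  let ?N = "distr M borel (\<lambda>x. x)"
  (* Every factor decays at least like the power 1 + sigma of the distance. *)
  define \<sigma> where "\<sigma> = Min (range (\<lambda>j. Re (\<alpha> $ j) + Re (\<beta> $ j) + 1))"
  have "\<sigma> \<in> range (\<lambda>j. Re (\<alpha> $ j) + Re (\<beta> $ j) + 1)"
    unfolding \<sigma>_def by (intro Min_in) auto
  then obtain i where "\<sigma> = Re (\<alpha> $ i) + Re (\<beta> $ i) + 1"
    by blast
  then have \<sigma>: "0 < \<sigma>"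
    using \<alpha>\<beta>[of i] by simp
  have \<sigma>_le: "\<sigma> \<le> Re (\<alpha> $ j) + Re (\<beta> $ j) + 1" for j
    unfolding \<sigma>_def by (intro Min_le) auto
  define q where "q = 1 / 2 powr (1 + \<sigma>)"
  have q: "0 < q" "q < 1 / 2"
    using \<sigma> powr_less_mono[of 1 "1 + \<sigma>" 2] by (simp_all add: q_def field_simps)
  have "inj (\<lambda>m::nat. \<lambda>_::'n. m)"
    by (auto simp: inj_on_def fun_eq_iff)
  then have "infinite (UNIV :: ('n \<Rightarrow> nat) set)"
    using range_inj_infinite infinite_super[OF subset_UNIV] by blast
  then obtain e :: "nat \<Rightarrow> 'n \<Rightarrow> nat" where e: "bij e"
    using bij_betw_from_nat_into[of "UNIV :: ('n \<Rightarrow> nat) set"] by auto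
  have m: "(\<lambda>x. x) \<in> M \<rightarrow>\<^sub>M borel"
    unfolding measurable_cong_sets[OF sets refl] by (rule measurable_restrict_space1) simp
  interpret M: finite_measure M by fact
  have space: "space M = torus"
    using sets_eq_imp_space_eq[OF sets] by (simp add: space_restrict_space)
  have finN: "finite_measure ?N"
    by (rule M.finite_measure_distr[OF m])
  note Eb = borel_if_sets_haar_torus[OF E(1)]
  have "(\<lambda>x. x) -` (- E) \<inter> space M = torus - E"
    by (auto simp: space)
  then have EN: "emeasure ?N (- E) = 0"
    using E(3) Eb by (subst emeasure_distr[OF m]) auto
  note majorant = AE_poisson_majorant_tendsto_0[OF finN sets_distr E(1,2) EN q bij_is_inj[OF e]]
  have "AE \<eta> in haar_torus. \<eta> \<in> torus"
    using AE_space[of haar_torus] by (simp add: space_haar_torus)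
  with majorant show ?thesis
  proof eventually_elim
    case (elim \<eta>)
    then have \<eta>: "\<eta> \<in> torus" by simp
    show ?case
      unfolding RNT_lim_def
    proof (intro allI impI)
      fix A B \<epsilon> :: real assume A: "0 < A" and B: "1 \<le> B" and \<epsilon>: "0 < \<epsilon>"
      obtain K where K: "0 \<le> K" and dyadic: "\<And>\<eta> \<zeta> z t. \<eta> \<in> torus \<Longrightarrow> \<zeta> \<in> torus \<Longrightarrow> 0 < t \<Longrightarrow>
          (\<And>j. z $ j \<in> stolz A (\<eta> $ j)) \<Longrightarrow>
          (\<And>j. t / B \<le> 1 - cmod (z $ j)) \<Longrightarrow> (\<And>j. 1 - cmod (z $ j) \<le> B * t) \<Longrightarrow>
          \<exists>k. \<zeta> \<in> ellipsoid k \<eta> (of_nat CARD('n) * t) \<and>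
            cmod (poisson_kernel \<alpha> \<beta> z \<zeta>) \<le> K * (\<Prod>j\<in>UNIV. q ^ k j) / t ^ CARD('n)"
        unfolding q_def
        by (rule poisson_kernel_le_dyadic[of A B \<sigma> \<alpha> \<beta>, OF A B \<sigma> \<sigma>_le]) blast
      have "((\<lambda>t. K * poisson_majorant q e ?N \<eta> t) \<longlongrightarrow> K * 0) (at_right 0)"
        using elim by (intro tendsto_mult_left) simp
      then have "eventually (\<lambda>t. K * poisson_majorant q e ?N \<eta> t < \<epsilon>) (at_right 0)"
        using \<epsilon> by (intro order_tendstoD) simp_all
      moreover define P where "P t \<longleftrightarrow> K * poisson_majorant q e ?N \<eta> t < \<epsilon> \<and>
          summable (\<lambda>i. (\<Prod>j\<in>UNIV. q ^ e i j) *
            (measure ?N (ellipsoid (e i) \<eta> (of_nat CARD('n) * t)) / t ^ CARD('n)))" for t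
      ultimately have "eventually P (at_right 0)"
        using elim unfolding P_def by (simp add: eventually_conj_iff)
      then obtain \<delta> where \<delta>: "0 < \<delta>" "\<And>t. 0 < t \<Longrightarrow> t < \<delta> \<Longrightarrow> P t"
        unfolding eventually_at_right_field by blast
      show "\<exists>\<delta>>0. \<forall>z. norm (z - \<eta>) < \<delta> \<and> z \<in> restricted_stolz A B \<eta> \<longrightarrow>
          cmod ((\<integral>\<zeta>. poisson_kernel \<alpha> \<beta> z \<zeta> \<partial>M) - 0) < \<epsilon>"
      proof (intro exI[of _ \<delta>] conjI allI impI \<delta>(1))
        fix z assume z: "norm (z - \<eta>) < \<delta> \<and> z \<in> restricted_stolz A B \<eta>"
        (* Any coordinate will do, since all distances to the circle are comparable. *)
        define t where "t = 1 - cmod (z $ undefined)"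
        note comparable = restricted_stolz_comparable[OF \<eta> B conjunct2[OF z]]
        have t: "0 < t" "t < \<delta>"
          using comparable(1,2)[of undefined] z by (auto simp: t_def)
        have P: "K * poisson_majorant q e ?N \<eta> t < \<epsilon>" "summable (\<lambda>i. (\<Prod>j\<in>UNIV. q ^ e i j) *
            (measure ?N (ellipsoid (e i) \<eta> (of_nat CARD('n) * t)) / t ^ CARD('n)))"
          using \<delta>(2)[OF t] by (simp_all add: P_def)
        have "cmod (\<integral>\<zeta>. poisson_kernel \<alpha> \<beta> z \<zeta> \<partial>M) \<le> K * poisson_majorant q e ?N \<eta> t"
        proof (rule integral_le_poisson_majorant[OF fin sets bij_is_surj[OF e] t(1) K less_imp_le[OF q(1)] _ P(2)])
          fix \<zeta> :: "complex ^ 'n" assume "\<zeta> \<in> torus"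
          then show "\<exists>k. \<zeta> \<in> ellipsoid k \<eta> (of_nat CARD('n) * t) \<and>
              cmod (poisson_kernel \<alpha> \<beta> z \<zeta>) \<le> K * (\<Prod>j\<in>UNIV. q ^ k j) / t ^ CARD('n)"
            by (rule dyadic[OF \<eta> _ t(1)]) (use comparable in \<open>simp_all add: t_def\<close>)
        qed
        also have "\<dots> < \<epsilon>"
          by (rule P(1))
        finally show "cmod ((\<integral>\<zeta>. poisson_kernel \<alpha> \<beta> z \<zeta> \<partial>M) - 0) < \<epsilon>"
          by simp
      qed
    qed
  qed
qed

text \<open>
  Both variations of \<open>\<nu>\<close> vanish on subsets of the complement of \<open>E\<close>, as \<open>\<nu>\<close> itself vanishes there.
\<close>

lemma AE_RNT_lim_signed_integral:
  fixes \<alpha> \<beta> :: "complex ^ 'n::finite"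
  assumes \<alpha>\<beta>: "\<And>j. Re (\<alpha> $ j) + Re (\<beta> $ j) > -1"
    and \<nu>: "signed_measure (restrict_space borel torus) \<nu>"
    and E: "E \<in> sets haar_torus" "emeasure haar_torus E = 0"
      "\<And>A. A \<in> sets haar_torus \<Longrightarrow> A \<inter> E = {} \<Longrightarrow> \<nu> A = 0"
  shows "AE \<eta> in haar_torus.
    RNT_lim (\<lambda>z. signed_integral (restrict_space borel torus) \<nu> (poisson_kernel \<alpha> \<beta> z)) \<eta> 0"
proof -
  have var: "AE \<eta> in haar_torus.
      RNT_lim (\<lambda>z. \<integral>\<zeta>. poisson_kernel \<alpha> \<beta> z \<zeta> \<partial>pos_variation (restrict_space borel torus) r) \<eta> 0"
    if r: "signed_measure (restrict_space borel torus) r"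
      "\<And>A. A \<in> sets haar_torus \<Longrightarrow> A \<inter> E = {} \<Longrightarrow> r A = 0" for r
  proof (rule AE_RNT_lim_singular_measure[OF \<alpha>\<beta> finite_measure_pos_variation[OF r(1)]
        sets_pos_variation[OF r(1)] E(1,2)])
    have "torus - E \<in> sets haar_torus"
      using sets.compl_sets[OF E(1)] by (simp add: space_haar_torus)
    then have "torus - E \<in> sets (restrict_space borel torus)"
      by (simp add: sets_haar_torus)
    then have "emeasure (pos_variation (restrict_space borel torus) r) (torus - E) =
        (SUP B \<in> {B \<in> sets (restrict_space borel torus). B \<subseteq> torus - E}. ennreal (r B))"
      by (rule emeasure_pos_variation[OF r(1)])
    also have "\<dots> \<le> 0"
    proof (rule SUP_least)
      fix B assume "B \<in> {B \<in> sets (restrict_space borel torus). B \<subseteq> torus - E}"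
      then have "r B = 0"
        by (intro r(2)) (auto simp: sets_haar_torus)
      then show "ennreal (r B) \<le> 0"
        by simp
    qed
    finally show "emeasure (pos_variation (restrict_space borel torus) r) (torus - E) = 0"
      by simp
  qed
  from var[OF \<nu> E(3)] var[OF signed_measure_uminus[OF \<nu>]]
  have "AE \<eta> in haar_torus.
      RNT_lim (\<lambda>z. \<integral>\<zeta>. poisson_kernel \<alpha> \<beta> z \<zeta> \<partial>pos_variation (restrict_space borel torus) \<nu>) \<eta> 0"
    "AE \<eta> in haar_torus.
      RNT_lim (\<lambda>z. \<integral>\<zeta>. poisson_kernel \<alpha> \<beta> z \<zeta> \<partial>pos_variation (restrict_space borel torus) (\<lambda>A. - \<nu> A)) \<eta> 0"
    using E(3) by simp_all
  then show ?thesis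
  proof eventually_elim
    case (elim \<eta>)
    from RNT_lim_zero_linear[OF this, of "-1"] show ?case
      by (simp add: signed_integral_def)
  qed
qed

theorem theorem4p10:
  fixes \<alpha> \<beta> :: "complex ^ 'n::finite"
    and \<mu> :: "(complex ^ 'n) set \<Rightarrow> complex"
  assumes "\<And>j. Re (\<alpha> $ j) + Re (\<beta> $ j) > -1"
    and "\<And>j (k::nat). k \<ge> 1 \<Longrightarrow> \<alpha> $ j \<noteq> - of_nat k"
    and "\<And>j (k::nat). k \<ge> 1 \<Longrightarrow> \<beta> $ j \<noteq> - of_nat k"
    and "complex_measure (restrict_space borel torus) \<mu>"
    and "cmeasure_singular haar_torus \<mu>"
  shows "AE \<zeta> in haar_torus. RNT_lim (poisson_integral \<alpha> \<beta> \<mu>) \<zeta> 0"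
proof -
  obtain E where E: "E \<in> sets haar_torus" "emeasure haar_torus E = 0"
      "\<And>A. A \<in> sets haar_torus \<Longrightarrow> A \<inter> E = {} \<Longrightarrow> \<mu> A = 0"
    using assms(5) unfolding cmeasure_singular_def by blast
  have "AE \<eta> in haar_torus. RNT_lim (\<lambda>z. signed_integral (restrict_space borel torus)
      (\<lambda>A. Re (\<mu> A)) (poisson_kernel \<alpha> \<beta> z)) \<eta> 0"
    by (rule AE_RNT_lim_signed_integral[OF assms(1) signed_measure_Re[OF assms(4)] E(1,2)]) (simp add: E(3))
  moreover have "AE \<eta> in haar_torus. RNT_lim (\<lambda>z. signed_integral (restrict_space borel torus)
      (\<lambda>A. Im (\<mu> A)) (poisson_kernel \<alpha> \<beta> z)) \<eta> 0"
    by (rule AE_RNT_lim_signed_integral[OF assms(1) signed_measure_Im[OF assms(4)] E(1,2)]) (simp add: E(3))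
  ultimately show ?thesis
  proof eventually_elim
    case (elim \<eta>)
    from RNT_lim_zero_linear[OF this, of \<i>] show ?case
      unfolding poisson_integral_def[abs_def] cmeasure_integral_def .
  qed
qed

end
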